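(* Let $A$ be a real positive-semidefinite matrix of size $n \times n$. Given an integer $k$ with $1 \le k \le n$, let $\tau$ denote the coherence of a dominant $k$-dimensional invariant subspace of $A$. Fix a nonzero failure probability $\delta \in (0,1]$. Let $\ell$ be an integer with $1 \le \ell \le n$ and $$\ell \ge 8 \tau k \log(k/\delta).$$ If $\ell$ columns of $A$ are chosen uniformly at random without replacement and used to form the Nyström extension $C W^\dagger C^t$, then $$\|A - C W^\dagger C^t\|_2 \le \lambda_{k+1}(A)\left(1 + \frac{2n}{\ell}\right)$$ with probability exceeding $1-\delta$.
   Context: All matrices are real; $\|\cdot\|_2$ is the spectral norm, $(\cdot)^t$ the transpose, $(\cdot)^\dagger$ the Moore–Penrose pseudoinverse, and $\log$ the natural logarithm. The eigenvalues of a positive-semidefinite $A$ of size $n$ are ordered $\lambda_1(A) \ge \lambda_2(A) \ge \cdots \ge \lambda_n(A)$, counted with multiplicity; $\lambda_{n+1}(A)$ is interpreted as $0$. A dominant $k$-dimensional invariant subspace of $A$ is the span of $k$ orthonormal eigenvectors of $A$ with eigenvalues $\lambda_1(A), \dots, \lambda_k(A)$ (it need not be unique; any choice is allowed). The coherence of a $k$-dimensional subspace $\mathcal{S}$ of $\mathbb{R}^n$ is $\mu_0(\mathcal{S}) = \frac{n}{k}\max_i (P_{\mathcal{S}})_{ii}$, where $P_{\mathcal{S}}$ is the orthogonal projection onto $\mathcal{S}$. Nyström extension: given a choice of $\ell$ columns of $A$, $C$ is the $n\times \ell$ matrix consisting of these columns, and $W$ is the $\ell\times\ell$ principal submatrix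 of $A$ formed by the intersection of these columns with the corresponding rows. Equivalently, $C = AS$ and $W = S^tAS$, where, for uniform sampling without replacement, $S$ is distributed as the first $\ell$ columns of a uniformly random $n \times n$ permutation matrix. *)

theory Defs
  imports "HOL-Probability.Probability"
begin

definition positive_semidefinite :: "real^'n^'n \<Rightarrow> bool" where
  "positive_semidefinite A \<longleftrightarrow> transpose A = A \<and> (\<forall>x. 0 \<le> x \<bullet> (A *v x))"

definition spectral_norm :: "real^'n^'m \<Rightarrow> real" where
  "spectral_norm A = onorm ((*v) A)"

definition charpoly :: "real^'n^'n \<Rightarrow> real poly" where
  "charpoly A = det (mat [:0, 1:] - (\<chi> i j. [:A $ i $ j:]))"

text \<open>
  Real eigenvalues with algebraic multiplicity, in decreasing order. For a symmetric matrix
  these are all the eigenvalues, so the list has length \<open>CARD('n)\<close>.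
\<close>
definition eigenvalues_desc :: "real^'n^'n \<Rightarrow> real list" where
  "eigenvalues_desc A = rev (sorted_list_of_multiset (proots (charpoly A)))"

text \<open>The index starts at 1; the value beyond the last eigenvalue is 0.\<close>
definition eigval :: "real^'n^'n \<Rightarrow> nat \<Rightarrow> real" where
  "eigval A j = (if 1 \<le> j \<and> j \<le> length (eigenvalues_desc A)
                 then eigenvalues_desc A ! (j - 1) else 0)"

definition dominant_invariant_subspace :: "real^'n^'n \<Rightarrow> nat \<Rightarrow> (real^'n) set \<Rightarrow> bool" where
  "dominant_invariant_subspace A k S \<longleftrightarrow>
     (\<exists>u :: nat \<Rightarrow> real^'n.
        (\<forall>i\<in>{1..k}. \<forall>j\<in>{1..k}. u i \<bullet> u j = (if i = j then 1 else 0)) \<and>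
        (\<forall>i\<in>{1..k}. A *v u i = eigval A i *\<^sub>R u i) \<and>
        S = span (u ` {1..k}))"

definition orth_proj :: "(real^'n) set \<Rightarrow> real^'n \<Rightarrow> real^'n" where
  "orth_proj S x = (THE y. y \<in> S \<and> (\<forall>z\<in>S. orthogonal (x - y) z))"

definition coherence :: "(real^'n) set \<Rightarrow> real" where
  "coherence S =
     real CARD('n) / real (dim S) * (MAX i\<in>UNIV. matrix (orth_proj S) $ i $ i)"

text \<open>The Moore--Penrose pseudoinverse, as the unique solution of the four Penrose equations.\<close>
definition pinv :: "real^'n^'m \<Rightarrow> real^'m^'n" where
  "pinv A = (THE X. A ** X ** A = A \<and> X ** A ** X = X \<and>
                    transpose (A ** X) = A ** X \<and> transpose (X ** A) = X ** A)"

text \<open>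
  A choice of \<open>CARD('l)\<close> columns is an injection \<open>c :: 'l \<Rightarrow> 'n\<close>; column \<open>j\<close> of the sampled
  matrix is column \<open>c j\<close> of the original one.
\<close>
definition sampled_columns :: "real^'n^'n \<Rightarrow> ('l \<Rightarrow> 'n) \<Rightarrow> real^'l^'n" where
  "sampled_columns A c = (\<chi> i j. A $ i $ c j)"

definition sampled_submatrix :: "real^'n^'n \<Rightarrow> ('l \<Rightarrow> 'n) \<Rightarrow> real^'l^'l" where
  "sampled_submatrix A c = (\<chi> i j. A $ c i $ c j)"

definition nystrom_extension :: "real^'n^'n \<Rightarrow> ('l::finite \<Rightarrow> 'n) \<Rightarrow> real^'n^'n" where
  "nystrom_extension A c =
     sampled_columns A c ** pinv (sampled_submatrix A c) ** transpose (sampled_columns A c)"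

text \<open>
  A uniformly random injection has the same law as the positions of the ones in the first
  \<open>CARD('l)\<close> columns of a uniformly random permutation matrix. It exists only if
  \<open>CARD('l) \<le> CARD('n)\<close>.
\<close>
definition uniform_without_replacement :: "('l::finite \<Rightarrow> 'n::finite) pmf" where
  "uniform_without_replacement = pmf_of_set {c. inj c}"

end

theory Submission
  imports Defs
begin

text \<open>
  Let \<open>P\<close> be the orthogonal projection onto the dominant subspace \<open>S\<close>, and let \<open>Z\<close> be the matrix
  that selects the sampled columns. The quadratic form of \<open>A - C W\<^sup>\<dagger> C\<^sup>t\<close> at \<open>x\<close> is the minimum over \<open>w\<close>
  of the \<open>A\<close>-seminorm (squared) of \<open>x - Z w\<close> (\<open>Nystrom_residual_form\<close>), so any \<open>w\<close> gives an upper bound.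
  A \<open>w\<close> with \<open>P (x - Z w) = 0\<close> leaves a residual orthogonal to \<open>S\<close>, where the form of \<open>A\<close> is at most
  \<open>\<lambda>\<^sub>k\<^sub>+\<^sub>1\<close> times the squared norm (\<open>quadratic_form_le_next_eigval\<close>), and there is one whose squared norm is at most \<open>2n/l\<close> times that of \<open>P x\<close> as soon as the squares of the sampled
  coordinates of every \<open>z\<close> in \<open>S\<close> add up to at least \<open>l/(2n)\<close> times the squared norm of \<open>z\<close>. This is
  \<open>Nystrom_error_le\<close>.

  With \<open>y i = P e\<^sub>i\<close> the condition says that the smallest eigenvalue on \<open>S\<close> of the sum of \<open>y i (y i)\<^sup>t\<close> over
  the sample is at least half its mean \<open>l/n\<close>. The vectors satisfy \<open>|y i|\<^sup>2 \<le> R\<close> where \<open>n R = k \<tau>\<close>, and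
  their outer products sum to \<open>P\<close>; \<open>matrix_Chernoff_without_replacement\<close> bounds the probability of failure.
  Its proof follows a trace potential along the sampling. Write \<open>B\<close> for the sum of the outer
  products that have not been drawn yet. In place of the trace of \<open>exp (a B)\<close> the potential is the trace of
  \<open>(I + (a/p) B)\<^sup>p\<close> for a natural number \<open>p\<close>, and \<open>p\<close> tends to infinity only in the final scalar inequality.
  Drawing \<open>y\<close> subtracts a rank-one operator. The derivative of a trace of a power along such a
  subtraction is explicit, and the Chebyshev sum inequality for the eigenvalues bounds how fast it
  decays (\<open>op_trace_rank_one_down_le\<close>). This estimate does the work that the Golden--Thompson inequality does
  for exponentials.

  Sampling without replacement is treated directly. The candidates for the next draw are exactly the
  terms of \<open>B\<close>, so the average decrease of the potential is again a trace of a function of \<open>B\<close>, and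
  Bernoulli's inequality for each eigenvalue turns it into a smaller parameter \<open>a\<close>
  (\<open>potential_average_insert_le\<close>). Running this recursion backwards over all \<open>l\<close> draws gives the same exponent as
  independent draws would. With \<open>ln 2 / R\<close> as the parameter after the last draw, the failure probability is at most
  \<open>k exp (- ((1 - ln 2)/2) l/(k \<tau>))\<close>, and \<open>(1 - ln 2)/2 > 1/8\<close> makes it strictly less than \<open>\<delta>\<close>.
\<close>

section \<open>Orthonormal eigenbases of self-adjoint operators\<close>

definition orthonormal :: "'a::euclidean_space set \<Rightarrow> bool" where
  "orthonormal B \<longleftrightarrow> (\<forall>b\<in>B. \<forall>c\<in>B. b \<bullet> c = (if b = c then 1 else 0))"

definition self_adjoint :: "('a::euclidean_space \<Rightarrow> 'a) \<Rightarrow> bool" where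
  "self_adjoint f \<longleftrightarrow> linear f \<and> (\<forall>x y. f x \<bullet> y = x \<bullet> f y)"

lemma orthonormal_independent:
  assumes "orthonormal B"
  shows "independent B"
proof (rule pairwise_orthogonal_independent)
  show "pairwise orthogonal B"
    using assms by (auto simp: pairwise_def orthogonal_def orthonormal_def)
  show "0 \<notin> B"
    using assms by (force simp: orthonormal_def)
qed

lemma orthonormal_finite: "orthonormal B \<Longrightarrow> finite B"
  using orthonormal_independent independent_imp_finite by blast

lemma orthonormal_expand:
  assumes "orthonormal B" "x \<in> span B"
  shows "(\<Sum>b\<in>B. (x \<bullet> b) *\<^sub>R b) = x"
proof (rule orthonormal_basis_expand)
  show "pairwise orthogonal B"
    using assms by (auto simp: pairwise_def orthogonal_def orthonormal_def)
  show "\<And>b. b \<in> B \<Longrightarrow> norm b = 1"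
    using assms by (simp add: orthonormal_def norm_eq_sqrt_inner)
qed (use assms orthonormal_finite in auto)

lemma orthonormal_inner:
  assumes "orthonormal B" "x \<in> span B"
  shows "x \<bullet> y = (\<Sum>b\<in>B. (x \<bullet> b) * (y \<bullet> b))"
proof -
  have "x \<bullet> y = (\<Sum>b\<in>B. (x \<bullet> b) *\<^sub>R b) \<bullet> y"
    by (simp add: orthonormal_expand[OF assms])
  also have "\<dots> = (\<Sum>b\<in>B. (x \<bullet> b) * (y \<bullet> b))"
    by (simp only: inner_sum_left inner_scaleR_left inner_commute[of y])
  finally show ?thesis .
qed

lemma orthonormal_Basis: "orthonormal Basis"
  by (simp add: orthonormal_def inner_Basis)

lemma self_adjoint_linear: "self_adjoint f \<Longrightarrow> linear f"
  by (simp add: self_adjoint_def)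

lemma self_adjointD: "self_adjoint f \<Longrightarrow> f x \<bullet> y = x \<bullet> f y"
  by (simp add: self_adjoint_def)

lemma self_adjoint_funpow:
  assumes "self_adjoint f"
  shows "self_adjoint (f ^^ m)"
proof -
  have lin: "linear (f ^^ m)"
  proof (induction m)
    case 0 then show ?case by (simp add: linear_id[unfolded id_def] id_def)
  next
    case (Suc m) then show ?case
      using linear_compose[OF Suc self_adjoint_linear[OF assms]] by (simp add: o_def)
  qed
  have "(f ^^ m) x \<bullet> y = x \<bullet> (f ^^ m) y" for x y
  proof (induction m arbitrary: x y)
    case (Suc m)
    have "(f ^^ Suc m) x \<bullet> y = (f ^^ m) x \<bullet> f y"
      by (simp add: self_adjointD[OF assms])
    also have "\<dots> = x \<bullet> (f ^^ m) (f y)" by (rule Suc)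
    finally show ?case by (simp add: funpow_swap1)
  qed simp
  with lin show ?thesis by (simp add: self_adjoint_def)
qed

text \<open>
  Moving from \<open>x\<close> by \<open>e w\<close>, where \<open>w\<close> is the residual \<open>f x - c x\<close>, changes
  \<open>x \<bullet> f x - c (x \<bullet> x)\<close> by \<open>2 e |w|\<^sup>2\<close> to first order. At a maximizer this first-order term must vanish.
\<close>
lemma Rayleigh_maximizer_eigenvector:
  assumes f: "self_adjoint f" and V: "subspace V" "\<And>x. x \<in> V \<Longrightarrow> f x \<in> V"
    and x: "x \<in> V" and max: "\<And>y. y \<in> V \<Longrightarrow> y \<bullet> f y \<le> c * (y \<bullet> y)" and eq: "x \<bullet> f x = c * (x \<bullet> x)"
  shows "f x = c *\<^sub>R x"
proof (rule ccontr)
  define w where "w = f x - c *\<^sub>R x"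
  assume "f x \<noteq> c *\<^sub>R x"
  then have w: "w \<bullet> w > 0" by (simp add: w_def)
  have wV: "w \<in> V" using V x by (simp add: w_def subspace_diff subspace_scale)
  define q where "q = w \<bullet> f w - c * (w \<bullet> w)"
  have ineq: "2 * e * (w \<bullet> w) + e\<^sup>2 * q \<le> 0" for e
  proof -
    have "x + e *\<^sub>R w \<in> V" using V x wV by (simp add: subspace_add subspace_scale)
    from max[OF this]
    have "(x + e *\<^sub>R w) \<bullet> f (x + e *\<^sub>R w) - c * ((x + e *\<^sub>R w) \<bullet> (x + e *\<^sub>R w)) \<le> 0"
      by simp
    also have "f (x + e *\<^sub>R w) = f x + e *\<^sub>R f w"
      using self_adjoint_linear[OF f] by (simp add: linear_add linear_scale)
    finally have "(x \<bullet> f x - c * (x \<bullet> x)) + e * (x \<bullet> f w + w \<bullet> f x - 2 * c * (x \<bullet> w)) + e\<^sup>2 * q \<le> 0"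
      by (simp add: q_def algebra_simps power2_eq_square inner_commute)
    moreover have "x \<bullet> f w = w \<bullet> f x"
      using self_adjointD[OF f, of x w] by (simp add: inner_commute)
    moreover have "w \<bullet> f x - c * (x \<bullet> w) = w \<bullet> w"
      by (simp add: w_def inner_diff_right inner_diff_left inner_commute algebra_simps)
    ultimately show ?thesis using eq by (simp add: algebra_simps)
  qed
  \<comment> \<open>small enough for the quadratic term to be dominated by the linear one\<close>
  define e where "e = (w \<bullet> w) / (1 + \<bar>q\<bar>)"
  have e: "e > 0" using w by (simp add: e_def add_pos_nonneg)
  have "e * \<bar>q\<bar> \<le> w \<bullet> w" 
    using w by (simp add: e_def field_simps)
  then have "- (e * q) \<le> w \<bullet> w" using e
    by (smt (verit) abs_le_iff abs_mult_pos mult_minus_right mult_left_mono abs_ge_minus_self)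
  then have "2 * (w \<bullet> w) + e * q > 0" using w by linarith
  then have "e * (2 * (w \<bullet> w) + e * q) > 0" using e by simp
  with ineq[of e] show False by (simp add: algebra_simps power2_eq_square)
qed

lemma Rayleigh_maximum_exists:
  fixes f :: "'a::euclidean_space \<Rightarrow> 'a"
  assumes f: "linear f" and V: "subspace V" "V \<noteq> {0}"
  obtains x c where "x \<in> V" "norm x = 1" "\<And>y. y \<in> V \<Longrightarrow> y \<bullet> f y \<le> c * (y \<bullet> y)" "x \<bullet> f x = (c::real)"
proof -
  let ?K = "V \<inter> sphere 0 1"
  have "compact ?K"
    using closed_subspace[OF V(1)] by (simp add: closed_Int_compact)
  moreover obtain v where v: "v \<in> V" "v \<noteq> 0"
    using V subspace_0 by blast
  then have "v /\<^sub>R norm v \<in> ?K" using V(1) by (simp add: subspace_scale)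
  then have "?K \<noteq> {}" by blast
  moreover have "continuous_on ?K (\<lambda>x. x \<bullet> f x)"
    by (intro continuous_intros linear_continuous_on) (use f linear_conv_bounded_linear in blast)
  ultimately obtain x where x: "x \<in> ?K" "\<And>y. y \<in> ?K \<Longrightarrow> y \<bullet> f y \<le> x \<bullet> f x"
    using continuous_attains_sup by (metis (no_types, lifting))
  show ?thesis
  proof
    show "x \<in> V" "norm x = 1" using x by auto
    show "x \<bullet> f x = x \<bullet> f x" ..
    fix y assume y: "y \<in> V"
    show "y \<bullet> f y \<le> (x \<bullet> f x) * (y \<bullet> y)"
    proof (cases "y = 0")
      case False
      then have "y /\<^sub>R norm y \<in> ?K" using V(1) y by (simp add: subspace_scale)
      from x(2)[OF this] have "(y \<bullet> f y) / (norm y)\<^sup>2 \<le> x \<bullet> f x"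
        using f by (simp add: linear_scale power2_eq_square field_simps)
      then show ?thesis using False by (simp add: field_simps power2_norm_eq_inner)
    qed (simp add: linear_0[OF f])
  qed
qed

text \<open>
  Split off a maximizer of the Rayleigh quotient and continue in its orthogonal complement within
  \<open>V\<close>. Allowing an invariant subspace instead of the whole space makes it possible to complete a given
  family of eigenvectors to an eigenbasis.
\<close>
lemma spectral_theorem:
  assumes f: "self_adjoint f" and "subspace V" "\<And>x. x \<in> V \<Longrightarrow> f x \<in> V"
  shows "\<exists>B. orthonormal B \<and> span B = V \<and> (\<forall>b\<in>B. f b = (b \<bullet> f b) *\<^sub>R b)"
  using assms(2,3)
proof (induction "dim V" arbitrary: V rule: less_induct)
  case less
  show ?case
  proof (cases "V = {0}")
    case True
    then show ?thesis by (intro exI[of _ "{}"]) (auto simp: orthonormal_def)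
  next
    case False
    obtain x c where x: "x \<in> V" "norm x = 1" and c: "\<And>y. y \<in> V \<Longrightarrow> y \<bullet> f y \<le> c * (y \<bullet> y)" "x \<bullet> f x = c"
      using Rayleigh_maximum_exists[OF self_adjoint_linear[OF f] less.prems(1) False] by metis
    have xx: "x \<bullet> x = 1" using x by (simp add: norm_eq_1)
    have fx: "f x = c *\<^sub>R x"
      using Rayleigh_maximizer_eigenvector[OF f less.prems x(1) c(1)] c(2) xx by simp
    define U where "U = V \<inter> {y. x \<bullet> y = 0}"
    have U: "subspace U"
      unfolding U_def by (intro subspace_inter less.prems subspace_hyperplane)
    have Uf: "f y \<in> U" if "y \<in> U" for y
      using that less.prems(2) self_adjointD[OF f, of x y] by (auto simp: U_def fx)
    have "x \<notin> U" using xx by (simp add: U_def)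
    then have "dim U < dim V"
      using x(1) U less.prems(1) by (metis U_def dim_psubset inf.cobounded1 psubsetI span_eq_iff)
    from less.hyps[OF this U Uf] obtain B where
      B: "orthonormal B" "span B = U" "\<forall>b\<in>B. f b = (b \<bullet> f b) *\<^sub>R b" by blast
    have xB: "x \<bullet> b = 0" if "b \<in> B" for b
      using that B(2) span_base by (auto simp: U_def)
    have "orthonormal (insert x B)"
      using B(1) xB xx by (auto simp: orthonormal_def inner_commute)
    moreover have "span (insert x B) = V"
    proof
      show "span (insert x B) \<subseteq> V"
        using x B(2) less.prems(1) by (intro span_minimal) (auto simp: U_def intro: span_base)
      show "V \<subseteq> span (insert x B)"
      proof
        fix v assume v: "v \<in> V"
        have "v - (x \<bullet> v) *\<^sub>R x \<in> span B"
          using v x xx less.prems(1) B(2) by (auto simp: U_def subspace_diff subspace_scale inner_diff_right)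
        then show "v \<in> span (insert x B)" by (auto simp: span_insert)
      qed
    qed
    moreover have "\<forall>b\<in>insert x B. f b = (b \<bullet> f b) *\<^sub>R b"
      using B(3) fx c(2) by auto
    ultimately show ?thesis by blast
  qed
qed

section \<open>Powers of operators and their traces\<close>

definition op_trace :: "('a::euclidean_space \<Rightarrow> 'a) \<Rightarrow> real" where
  "op_trace f = (\<Sum>b\<in>Basis. b \<bullet> f b)"

definition eigenbasis :: "('a::euclidean_space \<Rightarrow> 'a) \<Rightarrow> 'a set \<Rightarrow> bool" where
  "eigenbasis f B \<longleftrightarrow> orthonormal B \<and> span B = UNIV \<and> (\<forall>b\<in>B. f b = (b \<bullet> f b) *\<^sub>R b)"

lemma eigenbasis_exists: "self_adjoint f \<Longrightarrow> \<exists>B. eigenbasis f B"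
  using spectral_theorem[of f UNIV] by (auto simp: eigenbasis_def)

lemma card_eigenbasis:
  fixes f :: "'a::euclidean_space \<Rightarrow> 'a"
  assumes "eigenbasis f B" shows "card B = DIM('a)"
  using assms orthonormal_independent by (metis dim_UNIV dim_eq_card_independent dim_span eigenbasis_def)

lemma op_trace_orthonormal:
  assumes f: "self_adjoint f" and B: "orthonormal B" "span B = UNIV"
  shows "op_trace f = (\<Sum>b\<in>B. b \<bullet> f b)"
proof -
  have "e \<bullet> f e = (\<Sum>b\<in>B. (b \<bullet> e) * (f b \<bullet> e))" for e
  proof -
    have "e \<bullet> f e = (\<Sum>b\<in>B. (e \<bullet> b) * (f e \<bullet> b))"
      by (rule orthonormal_inner) (use B in auto)
    also have "\<dots> = (\<Sum>b\<in>B. (b \<bullet> e) * (f b \<bullet> e))"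
      by (simp only: self_adjointD[OF f, of e] inner_commute[of e])
    finally show ?thesis .
  qed
  then have "op_trace f = (\<Sum>e\<in>Basis. \<Sum>b\<in>B. (b \<bullet> e) * (f b \<bullet> e))"
    by (simp add: op_trace_def)
  also have "\<dots> = (\<Sum>b\<in>B. b \<bullet> f b)"
    by (subst sum.swap) (simp add: orthonormal_inner[OF orthonormal_Basis, symmetric])
  finally show ?thesis .
qed

lemma eigenbasis_funpow:
  assumes "self_adjoint f" "eigenbasis f B" "b \<in> B"
  shows "(f ^^ m) b = (b \<bullet> f b) ^ m *\<^sub>R b"
proof (induction m)
  case (Suc m)
  have "f b = (b \<bullet> f b) *\<^sub>R b" using assms by (auto simp: eigenbasis_def)
  then show ?case using self_adjoint_linear[OF assms(1)] Suc
    by (simp add: linear_scale) (metis mult.commute scaleR_scaleR)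
qed simp

lemma inner_funpow_eigenbasis:
  assumes f: "self_adjoint f" and B: "eigenbasis f B"
  shows "x \<bullet> (f ^^ m) x = (\<Sum>b\<in>B. (b \<bullet> f b) ^ m * (x \<bullet> b)\<^sup>2)"
proof -
  have B': "orthonormal B" "span B = UNIV" using B by (auto simp: eigenbasis_def)
  have "x \<bullet> (f ^^ m) x = (\<Sum>b\<in>B. (x \<bullet> b) * ((f ^^ m) x \<bullet> b))"
    by (rule orthonormal_inner) (use B' in auto)
  also have "\<dots> = (\<Sum>b\<in>B. (b \<bullet> f b) ^ m * (x \<bullet> b)\<^sup>2)"
    by (intro sum.cong refl)
      (simp add: self_adjointD[OF self_adjoint_funpow[OF f]] eigenbasis_funpow[OF f B] power2_eq_square)
  finally show ?thesis .
qed

lemma op_trace_funpow_eigenbasis: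
  assumes f: "self_adjoint f" and B: "eigenbasis f B"
  shows "op_trace (f ^^ m) = (\<Sum>b\<in>B. (b \<bullet> f b) ^ m)"
proof -
  have B': "orthonormal B" "span B = UNIV" using B by (auto simp: eigenbasis_def)
  have "b \<bullet> b = 1" if "b \<in> B" for b using that B' by (auto simp: orthonormal_def)
  then show ?thesis
    by (subst op_trace_orthonormal[OF self_adjoint_funpow[OF f] B'])
       (simp add: eigenbasis_funpow[OF f B])
qed

definition above_identity :: "('a::euclidean_space \<Rightarrow> 'a) \<Rightarrow> bool" where
  "above_identity Q \<longleftrightarrow> self_adjoint Q \<and> (\<forall>x. x \<bullet> x \<le> x \<bullet> Q x)"

lemma above_identity_eigenvalue:
  assumes "above_identity Q" "eigenbasis Q B" "b \<in> B"
  shows "1 \<le> b \<bullet> Q b"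
proof -
  have "b \<bullet> b = 1" using assms by (auto simp: eigenbasis_def orthonormal_def)
  then show ?thesis using assms(1) by (auto simp: above_identity_def dest: spec[of _ b])
qed

text \<open>
  The eigenvalues of \<open>Q\<close> are at least 1, so their powers grow with the exponent.
\<close>
lemma moment_mono:
  assumes Q: "above_identity Q" and "m \<le> m'"
  shows "y \<bullet> (Q ^^ m) y \<le> y \<bullet> (Q ^^ m') y"
proof -
  have sa: "self_adjoint Q" using Q by (simp add: above_identity_def)
  obtain B where B: "eigenbasis Q B" using eigenbasis_exists[OF sa] by blast
  show ?thesis unfolding inner_funpow_eigenbasis[OF sa B]
    by (intro sum_mono mult_right_mono power_increasing assms above_identity_eigenvalue[OF Q B]) auto
qed

lemma moment_nonneg:
  assumes "above_identity Q"
  shows "0 \<le> y \<bullet> (Q ^^ m) y"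
  using order_trans[OF inner_ge_zero moment_mono[OF assms, of 0 m y, simplified]] by simp

text \<open>
  Chebyshev's sum inequality: under the spectral weights \<open>(y \<bullet> b)\<^sup>2\<close> the functions \<open>\<mu>\<^sup>i\<close> and \<open>\<mu>\<^sup>j\<close> are
  both increasing in the eigenvalue, hence positively correlated.
\<close>
lemma moment_mult_le:
  assumes Q: "above_identity Q"
  shows "(y \<bullet> (Q ^^ i) y) * (y \<bullet> (Q ^^ j) y) \<le> (y \<bullet> y) * (y \<bullet> (Q ^^ (i + j)) y)"
proof -
  have sa: "self_adjoint Q" using Q by (simp add: above_identity_def)
  obtain B where B: "eigenbasis Q B" using eigenbasis_exists[OF sa] by blast
  define \<mu> p where "\<mu> b = b \<bullet> Q b" and "p b = (y \<bullet> b)\<^sup>2" for b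
  have mom: "y \<bullet> (Q ^^ m) y = (\<Sum>b\<in>B. \<mu> b ^ m * p b)" for m
    by (simp add: inner_funpow_eigenbasis[OF sa B] \<mu>_def p_def)
  have \<mu>: "1 \<le> \<mu> b" if "b \<in> B" for b
    using above_identity_eigenvalue[OF Q B that] by (simp add: \<mu>_def)
  have same_sign: "0 \<le> (\<mu> b ^ i - \<mu> c ^ i) * (\<mu> b ^ j - \<mu> c ^ j)" if "b \<in> B" "c \<in> B" for b c
  proof -
    have pos: "0 \<le> \<mu> b" "0 \<le> \<mu> c" using \<mu>[OF that(1)] \<mu>[OF that(2)] by auto
    show ?thesis
    proof (cases "\<mu> b \<le> \<mu> c")
      case True
      with pos show ?thesis by (intro mult_nonpos_nonpos) (auto intro: power_mono)
    next
      case False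
      with pos show ?thesis by (intro mult_nonneg_nonneg) (auto intro: power_mono)
    qed
  qed
  have "0 \<le> (\<Sum>b\<in>B. \<Sum>c\<in>B. p b * p c * ((\<mu> b ^ i - \<mu> c ^ i) * (\<mu> b ^ j - \<mu> c ^ j)))"
    by (intro sum_nonneg mult_nonneg_nonneg[OF mult_nonneg_nonneg] same_sign) (auto simp: p_def)
  also have "\<dots> = (\<Sum>b\<in>B. \<Sum>c\<in>B. p b * (\<mu> c ^ (i+j) * p c)) + (\<Sum>b\<in>B. \<Sum>c\<in>B. (\<mu> b ^ (i+j) * p b) * p c)
      - (\<Sum>b\<in>B. \<Sum>c\<in>B. (\<mu> b ^ i * p b) * (\<mu> c ^ j * p c)) - (\<Sum>b\<in>B. \<Sum>c\<in>B. (\<mu> b ^ j * p b) * (\<mu> c ^ i * p c))"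
    by (simp add: sum.distrib[symmetric] sum_subtractf[symmetric] algebra_simps power_add)
  also have "\<dots> = 2 * ((\<Sum>b\<in>B. p b) * (\<Sum>b\<in>B. \<mu> b ^ (i+j) * p b)
      - (\<Sum>b\<in>B. \<mu> b ^ i * p b) * (\<Sum>b\<in>B. \<mu> b ^ j * p b))"
    by (simp add: sum_product[symmetric])
  finally show ?thesis using mom[of 0] by (simp add: mom)
qed

section \<open>Rank-one updates of trace powers\<close>

definition rank_one_down :: "('a::euclidean_space \<Rightarrow> 'a) \<Rightarrow> 'a \<Rightarrow> real \<Rightarrow> 'a \<Rightarrow> 'a" where
  "rank_one_down Q y s x = Q x - (s * (y \<bullet> x)) *\<^sub>R y"

lemma self_adjoint_rank_one_down:
  assumes "self_adjoint Q"
  shows "self_adjoint (rank_one_down Q y s)"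
proof -
  have l: "linear Q" using assms by (simp add: self_adjoint_def)
  have "linear (rank_one_down Q y s)"
    by (rule linearI) (simp_all add: rank_one_down_def linear_add[OF l] linear_scale[OF l] algebra_simps)
  then show ?thesis
    using self_adjointD[OF assms]
    by (auto simp: self_adjoint_def rank_one_down_def inner_diff_left inner_diff_right inner_commute)
qed

text \<open>
  The product rule for noncommuting factors: each of the \<open>m\<close> factors is differentiated in turn,
  and contributes the rank-one operator between two smaller powers.
\<close>
lemma funpow_rank_one_down_deriv:
  assumes "self_adjoint Q"
  shows "((\<lambda>s. (rank_one_down Q y s ^^ m) x) has_vector_derivative
           - (\<Sum>i<m. (y \<bullet> (rank_one_down Q y s ^^ (m - Suc i)) x) *\<^sub>R (rank_one_down Q y s ^^ i) y)) (at s)"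
proof (induction m)
  case (Suc m)
  let ?R = "rank_one_down Q y"
  let ?D = "- (\<Sum>i<m. (y \<bullet> (?R s ^^ (m - Suc i)) x) *\<^sub>R (?R s ^^ i) y)"
  have l: "linear Q" using assms by (simp add: self_adjoint_def)
  have bl: "bounded_linear Q" using l linear_conv_bounded_linear by blast
  have lR: "linear (?R s)" using self_adjoint_rank_one_down[OF assms] by (simp add: self_adjoint_def)
  have Qd: "((\<lambda>t. Q ((?R t ^^ m) x)) has_vector_derivative Q ?D) (at s)"
    by (rule bounded_linear.has_vector_derivative[OF bl Suc])
  have yd: "((\<lambda>t. y \<bullet> (?R t ^^ m) x) has_vector_derivative y \<bullet> ?D) (at s)"
    by (rule bounded_linear.has_vector_derivative[OF bounded_linear_inner_right Suc])
  have "((\<lambda>t. t * (y \<bullet> (?R t ^^ m) x)) has_vector_derivative s * (y \<bullet> ?D) + 1 * (y \<bullet> (?R s ^^ m) x)) (at s)"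
    by (rule has_vector_derivative_mult[OF has_vector_derivative_id yd])
  then have "((\<lambda>t. (t * (y \<bullet> (?R t ^^ m) x)) *\<^sub>R y) has_vector_derivative
      (s * (y \<bullet> ?D) + 1 * (y \<bullet> (?R s ^^ m) x)) *\<^sub>R y) (at s)"
    by (rule bounded_linear.has_vector_derivative[OF bounded_linear_scaleR_left])
  from has_vector_derivative_diff[OF Qd this]
  have "((\<lambda>t. (?R t ^^ Suc m) x) has_vector_derivative
      Q ?D - (s * (y \<bullet> ?D) + 1 * (y \<bullet> (?R s ^^ m) x)) *\<^sub>R y) (at s)"
    by (simp add: rank_one_down_def)
  also have "Q ?D - (s * (y \<bullet> ?D) + 1 * (y \<bullet> (?R s ^^ m) x)) *\<^sub>R y
      = ?R s ?D - (y \<bullet> (?R s ^^ m) x) *\<^sub>R y"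
    by (simp add: rank_one_down_def algebra_simps)
  also have "?R s ?D = - (\<Sum>i<m. (y \<bullet> (?R s ^^ (m - Suc i)) x) *\<^sub>R (?R s ^^ Suc i) y)"
    using lR by (simp add: linear_neg linear_sum linear_scale)
  also have "\<dots> - (y \<bullet> (?R s ^^ m) x) *\<^sub>R y
      = - (\<Sum>i<Suc m. (y \<bullet> (?R s ^^ (Suc m - Suc i)) x) *\<^sub>R (?R s ^^ i) y)"
    by (subst sum.lessThan_Suc_shift) simp
  finally show ?case .
qed (simp add: has_vector_derivative_const)

lemma moment_rank_one_down_deriv:
  assumes "self_adjoint Q"
  shows "((\<lambda>s. y \<bullet> (rank_one_down Q y s ^^ m) y) has_real_derivative
     - (\<Sum>i<m. (y \<bullet> (rank_one_down Q y s ^^ (m - Suc i)) y) * (y \<bullet> (rank_one_down Q y s ^^ i) y))) (at s)"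
proof -
  have "((\<lambda>s. y \<bullet> (rank_one_down Q y s ^^ m) y) has_vector_derivative
    y \<bullet> - (\<Sum>i<m. (y \<bullet> (rank_one_down Q y s ^^ (m - Suc i)) y) *\<^sub>R (rank_one_down Q y s ^^ i) y)) (at s)"
    by (rule bounded_linear.has_vector_derivative[OF bounded_linear_inner_right funpow_rank_one_down_deriv[OF assms]])
  then show ?thesis
    by (simp add: has_real_derivative_iff_has_vector_derivative inner_sum_right)
qed

text \<open>
  Under the trace the factors commute cyclically, so the \<open>m + 1\<close> terms of the product rule
  coincide.
\<close>
lemma op_trace_rank_one_down_deriv:
  assumes "self_adjoint Q"
  shows "((\<lambda>s. op_trace (rank_one_down Q y s ^^ Suc m)) has_real_derivative
     - real (Suc m) * (y \<bullet> (rank_one_down Q y s ^^ m) y)) (at s)"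
proof -
  let ?R = "rank_one_down Q y s"
  have sa: "self_adjoint (?R ^^ i)" for i
    by (intro self_adjoint_funpow self_adjoint_rank_one_down assms)
  have swap: "y \<bullet> (?R ^^ i) b = (?R ^^ i) y \<bullet> b" "b \<bullet> (?R ^^ i) y = (?R ^^ i) y \<bullet> b" for b i
    using self_adjointD[OF sa, of i y b] by (simp_all add: inner_commute[of _ b])
  have "((\<lambda>s. op_trace (rank_one_down Q y s ^^ Suc m)) has_vector_derivative
    (\<Sum>b\<in>Basis. b \<bullet> - (\<Sum>i<Suc m. (y \<bullet> (?R ^^ (Suc m - Suc i)) b) *\<^sub>R (?R ^^ i) y))) (at s)"
    unfolding op_trace_def
    by (intro has_vector_derivative_sum bounded_linear.has_vector_derivative[OF bounded_linear_inner_right]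
          funpow_rank_one_down_deriv[OF assms])
  also have "(\<Sum>b\<in>Basis. b \<bullet> - (\<Sum>i<Suc m. (y \<bullet> (?R ^^ (Suc m - Suc i)) b) *\<^sub>R (?R ^^ i) y))
      = - (\<Sum>i<Suc m. \<Sum>b\<in>Basis. ((?R ^^ (m - i)) y \<bullet> b) * ((?R ^^ i) y \<bullet> b))"
    by (subst sum.swap)
      (simp only: inner_minus_right inner_sum_right inner_scaleR_right sum_negf swap diff_Suc_Suc)
  also have "\<dots> = - (\<Sum>i<Suc m. y \<bullet> (?R ^^ m) y)"
  proof -
    have "(\<Sum>b\<in>Basis. ((?R ^^ (m - i)) y \<bullet> b) * ((?R ^^ i) y \<bullet> b)) = y \<bullet> (?R ^^ m) y" if "i < Suc m" for i
    proof -
      have "(\<Sum>b\<in>Basis. ((?R ^^ (m - i)) y \<bullet> b) * ((?R ^^ i) y \<bullet> b)) = (?R ^^ (m - i)) y \<bullet> (?R ^^ i) y"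
        by (rule euclidean_inner[symmetric])
      also have "\<dots> = y \<bullet> (?R ^^ (m - i)) ((?R ^^ i) y)" by (rule self_adjointD[OF sa])
      also have "(?R ^^ (m - i)) ((?R ^^ i) y) = (?R ^^ m) y"
        using that by (metis funpow_add comp_apply le_add_diff_inverse2 less_Suc_eq_le)
      finally show ?thesis .
    qed
    then show ?thesis by (simp del: sum.lessThan_Suc)
  qed
  finally show ?thesis
    by (simp add: has_real_derivative_iff_has_vector_derivative del: funpow.simps of_nat_Suc)
qed

text \<open>
  By \<open>moment_mult_le\<close> each of the \<open>m\<close> products in the derivative of the moment \<open>h\<close> is at most \<open>|y|\<^sup>2 h\<close>, so
  \<open>h' \<ge> - m |y|\<^sup>2 h\<close>, and the moment decays no faster than the solution of the linear differential equation.
\<close>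
lemma moment_rank_one_down_ge:
  assumes Q: "self_adjoint Q" and s: "0 \<le> s"
    and above: "\<And>r. 0 \<le> r \<Longrightarrow> r \<le> s \<Longrightarrow> above_identity (rank_one_down Q y r)"
  shows "(y \<bullet> (Q ^^ m) y) * exp (- real m * (y \<bullet> y) * s) \<le> y \<bullet> (rank_one_down Q y s ^^ m) y"
proof -
  let ?x = "y \<bullet> y"
  define h where "h i r = y \<bullet> (rank_one_down Q y r ^^ i) y" for i r
  let ?h' = "\<lambda>r. - (\<Sum>i<m. h (m - Suc i) r * h i r)"
  have h': "(h m has_real_derivative ?h' r) (at r)" for r
    using moment_rank_one_down_deriv[OF Q, of y m r] by (simp add: h_def[abs_def])
  have "h m 0 * exp (real m * ?x * 0) \<le> h m s * exp (real m * ?x * s)"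
  proof (rule DERIV_nonneg_imp_nondecreasing[OF s])
    fix r assume r: "0 \<le> r" "r \<le> s"
    have A: "above_identity (rank_one_down Q y r)" using above r by blast
    have "(\<Sum>i<m. h (m - Suc i) r * h i r) \<le> (\<Sum>i<m. ?x * h m r)"
    proof (rule sum_mono)
      fix i assume i: "i \<in> {..<m}"
      have "h (m - Suc i) r * h i r \<le> ?x * h (m - Suc i + i) r"
        unfolding h_def by (rule moment_mult_le[OF A])
      also have "\<dots> \<le> ?x * h m r"
        unfolding h_def using i by (intro mult_left_mono moment_mono[OF A]) auto
      finally show "h (m - Suc i) r * h i r \<le> ?x * h m r" .
    qed
    then have "0 \<le> ?h' r + real m * ?x * h m r" by simp
    then have "0 \<le> (?h' r + real m * ?x * h m r) * exp (real m * ?x * r)" by simp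
    moreover have "((\<lambda>r. h m r * exp (real m * ?x * r)) has_real_derivative
        (?h' r + real m * ?x * h m r) * exp (real m * ?x * r)) (at r)"
      by (rule derivative_eq_intros h' refl | simp add: algebra_simps)+
    ultimately show "\<exists>d. ((\<lambda>r. h m r * exp (real m * ?x * r)) has_real_derivative d) (at r) \<and> 0 \<le> d"
      by blast
  qed
  moreover have "rank_one_down Q y 0 = Q" by (auto simp: rank_one_down_def)
  ultimately show ?thesis
    by (simp add: h_def exp_minus field_simps)
qed

text \<open>
  Integrate the derivative of the trace, using the exponential lower bound for the moment. For
  \<open>Q = I + B / (m + 1)\<close>, \<open>s = a / (m + 1)\<close> and large \<open>m\<close> this becomes the rank-one case of
  the Golden--Thompson inequality, \<open>tr exp (B - a y y\<^sup>t) \<le> tr (exp B exp (- a y y\<^sup>t))\<close>.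
\<close>
lemma op_trace_rank_one_down_le:
  assumes Q: "self_adjoint Q" and y: "y \<noteq> 0" and s: "0 \<le> s"
    and above: "\<And>r. 0 \<le> r \<Longrightarrow> r \<le> s \<Longrightarrow> above_identity (rank_one_down Q y r)"
  shows "op_trace (rank_one_down Q y s ^^ Suc m)
      \<le> op_trace (Q ^^ Suc m) - (y \<bullet> (Q ^^ m) y) * ((1 - exp (- real (Suc m) * (y \<bullet> y) * s)) / (y \<bullet> y))"
proof -
  let ?x = "y \<bullet> y" and ?M = "real (Suc m)"
  have x: "?x > 0" using y by simp
  define h where "h = y \<bullet> (Q ^^ m) y"
  define g where "g r = op_trace (rank_one_down Q y r ^^ Suc m)" for r
  have R0: "rank_one_down Q y 0 = Q" by (auto simp: rank_one_down_def)
  have Q1: "above_identity Q" using above[of 0] s by (simp add: R0)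
  have "g s + h * ((1 - exp (- ?M * ?x * s)) / ?x) \<le> g 0 + h * ((1 - exp (- ?M * ?x * 0)) / ?x)"
  proof (rule DERIV_nonpos_imp_nonincreasing[OF s])
    fix r assume r: "0 \<le> r" "r \<le> s"
    have g': "(g has_real_derivative - ?M * (y \<bullet> (rank_one_down Q y r ^^ m) y)) (at r)"
      using op_trace_rank_one_down_deriv[OF Q] by (simp add: g_def[abs_def])
    have "((\<lambda>r. h * ((1 - exp (- ?M * ?x * r)) / ?x)) has_real_derivative ?M * (h * exp (- ?M * ?x * r))) (at r)"
      using x by (auto intro!: derivative_eq_intros simp: field_simps)
    from DERIV_add[OF g' this] have D: "((\<lambda>r. g r + h * ((1 - exp (- ?M * ?x * r)) / ?x)) has_real_derivative
       - ?M * (y \<bullet> (rank_one_down Q y r ^^ m) y) + ?M * (h * exp (- ?M * ?x * r))) (at r)" .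
    have "h * exp (- ?M * ?x * r) \<le> h * exp (- real m * ?x * r)"
      using moment_nonneg[OF Q1] x r by (intro mult_left_mono) (auto simp: h_def algebra_simps)
    also have "\<dots> \<le> y \<bullet> (rank_one_down Q y r ^^ m) y"
      unfolding h_def using r above by (intro moment_rank_one_down_ge[OF Q]) auto
    finally have "?M * (h * exp (- ?M * ?x * r)) \<le> ?M * (y \<bullet> (rank_one_down Q y r ^^ m) y)"
      by (intro mult_left_mono) auto
    then have "- ?M * (y \<bullet> (rank_one_down Q y r ^^ m) y) + ?M * (h * exp (- ?M * ?x * r)) \<le> 0"
      by linarith
    then show "\<exists>d. ((\<lambda>r. g r + h * ((1 - exp (- ?M * ?x * r)) / ?x)) has_real_derivative d) (at r) \<and> d \<le> 0"
      using D by blast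
  qed
  then show ?thesis by (simp add: g_def h_def R0)
qed

section \<open>The trace potential of a partially sampled frame\<close>

text \<open>
  Concavity of \<open>1 - exp (- u)\<close>: it lies above its chord from 0 to \<open>v\<close>.
\<close>
lemma one_minus_exp_ge_chord:
  fixes u v :: real
  assumes "0 \<le> u" "u \<le> v" "0 < v"
  shows "(u / v) * (1 - exp (- v)) \<le> 1 - exp (- u)"
proof -
  have "exp (- u) = exp ((1 - u / v) *\<^sub>R 0 + (u / v) *\<^sub>R (- v))"
    using assms by simp
  also have "\<dots> \<le> (1 - u / v) * exp 0 + (u / v) * exp (- v)"
    using assms by (intro convex_onD[OF exp_convex]) auto
  finally show ?thesis by (simp add: algebra_simps)
qed

definition frame_rest :: "('i::finite \<Rightarrow> 'a::euclidean_space) \<Rightarrow> 'i set \<Rightarrow> 'a \<Rightarrow> 'a" where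
  "frame_rest y T x = (\<Sum>i\<in>-T. (y i \<bullet> x) *\<^sub>R y i)"

definition perturbed :: "('i::finite \<Rightarrow> 'a::euclidean_space) \<Rightarrow> real \<Rightarrow> 'i set \<Rightarrow> 'a \<Rightarrow> 'a" where
  "perturbed y c T x = x + c *\<^sub>R frame_rest y T x"

definition potential :: "('i::finite \<Rightarrow> 'a::euclidean_space) \<Rightarrow> nat \<Rightarrow> real \<Rightarrow> 'i set \<Rightarrow> real" where
  "potential y p a T = op_trace (perturbed y (a / real p) T ^^ p)"

lemma self_adjoint_frame_rest: "self_adjoint (frame_rest y T)"
proof -
  have "linear (frame_rest y T)"
    by (rule linearI)
       (simp_all add: frame_rest_def inner_add_right scaleR_add_left sum.distrib scaleR_sum_right)
  moreover have "frame_rest y T u \<bullet> v = u \<bullet> frame_rest y T v" for u v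
    by (simp add: frame_rest_def inner_sum_left inner_sum_right inner_commute[of u] mult.commute)
  ultimately show ?thesis by (simp add: self_adjoint_def)
qed

lemma frame_rest_quadratic: "x \<bullet> frame_rest y T x = (\<Sum>i\<in>-T. (y i \<bullet> x)\<^sup>2)"
  by (simp add: frame_rest_def inner_sum_right inner_commute[of x] power2_eq_square)

lemma frame_rest_nonneg: "0 \<le> x \<bullet> frame_rest y T x"
  by (simp add: frame_rest_quadratic sum_nonneg)

lemma self_adjoint_perturbed: "self_adjoint (perturbed y c T)"
proof -
  have l: "linear (frame_rest y T)" by (rule self_adjoint_linear[OF self_adjoint_frame_rest])
  have "linear (perturbed y c T)"
    by (rule linearI) (simp_all add: perturbed_def linear_add[OF l] linear_scale[OF l] algebra_simps)
  then show ?thesis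
    using self_adjointD[OF self_adjoint_frame_rest, of y T]
    by (simp add: self_adjoint_def perturbed_def inner_add_left inner_add_right)
qed

text \<open>
  Subtracting only the part \<open>s \<le> c\<close> of the outer product of \<open>y i\<close> stays above the operator in which
  \<open>i\<close> has been drawn. This keeps the whole path of rank-one updates above the identity.
\<close>
lemma rank_one_down_perturbed:
  assumes "i \<notin> T"
  shows "rank_one_down (perturbed y c T) (y i) s x
       = perturbed y c (insert i T) x + ((c - s) * (y i \<bullet> x)) *\<^sub>R y i"
proof -
  have "- T = insert i (- insert i T)" using assms by auto
  then have "frame_rest y T x = (y i \<bullet> x) *\<^sub>R y i + frame_rest y (insert i T) x"
    unfolding frame_rest_def by (metis (no_types, lifting) ComplD finite insertI1 sum.insert)
  then show ?thesis by (simp add: rank_one_down_def perturbed_def algebra_simps)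
qed

lemma eigenbasis_perturbed:
  assumes B: "eigenbasis (frame_rest y T) B"
  shows "eigenbasis (perturbed y c T) B"
    and "b \<in> B \<Longrightarrow> b \<bullet> perturbed y c T b = 1 + c * (b \<bullet> frame_rest y T b)"
proof -
  have bb: "b \<bullet> b = 1" if "b \<in> B" for b
    using B that by (auto simp: eigenbasis_def orthonormal_def)
  show *: "b \<bullet> perturbed y c T b = 1 + c * (b \<bullet> frame_rest y T b)" if "b \<in> B" for b
    using bb[OF that] by (simp add: perturbed_def inner_add_right)
  have "perturbed y c T b = (b \<bullet> perturbed y c T b) *\<^sub>R b" if "b \<in> B" for b
  proof -
    have "frame_rest y T b = (b \<bullet> frame_rest y T b) *\<^sub>R b" using B that by (auto simp: eigenbasis_def)
    then have "perturbed y c T b = b + (c * (b \<bullet> frame_rest y T b)) *\<^sub>R b"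
      unfolding perturbed_def by (metis scaleR_scaleR)
    then show ?thesis using *[OF that] by (simp add: scaleR_add_left)
  qed
  then show "eigenbasis (perturbed y c T) B" using B by (auto simp: eigenbasis_def)
qed

lemma potential_eigenbasis:
  assumes B: "eigenbasis (frame_rest y T) B"
  shows "potential y p a T = (\<Sum>b\<in>B. (1 + a / real p * (b \<bullet> frame_rest y T b)) ^ p)"
  unfolding potential_def
  by (subst op_trace_funpow_eigenbasis[OF self_adjoint_perturbed eigenbasis_perturbed(1)[OF B]])
     (auto intro!: sum.cong simp: eigenbasis_perturbed(2)[OF B])

lemma potential_mono:
  assumes "0 \<le> a" "a \<le> a'"
  shows "potential y p a T \<le> potential y p a' T"
proof -
  obtain B where B: "eigenbasis (frame_rest y T) B"
    using eigenbasis_exists[OF self_adjoint_frame_rest] by blast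
  show ?thesis unfolding potential_eigenbasis[OF B]
    using assms by (intro sum_mono power_mono add_mono mult_right_mono divide_right_mono order_refl
        frame_rest_nonneg add_nonneg_nonneg mult_nonneg_nonneg divide_nonneg_nonneg) auto
qed

text \<open>
  The exact rate from \<open>op_trace_rank_one_down_le\<close> depends on \<open>|y i|\<^sup>2\<close> and is concave in \<open>a\<close>. The chord
  bound replaces it by one that is linear in \<open>a\<close> and the same for all \<open>i\<close>.
\<close>
lemma potential_insert_le:
  assumes i: "i \<notin> T" and a: "0 \<le> a" "a \<le> \<theta>" and R: "y i \<bullet> y i \<le> R" "0 < R" and th: "0 < \<theta>"
  shows "potential y (Suc m) a (insert i T) \<le> potential y (Suc m) a T
     - (1 - exp (- (\<theta> * R))) / (\<theta> * R) * a * (y i \<bullet> (perturbed y (a / real (Suc m)) T ^^ m) (y i))"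
proof -
  define p where "p = Suc m"
  define c where "c = a / real p"
  have c: "0 \<le> c" "real p * c = a" using a by (auto simp: c_def p_def)
  let ?Q = "perturbed y c T"
  have above: "above_identity (rank_one_down ?Q (y i) r)" if "0 \<le> r" "r \<le> c" for r
  proof -
    have "x \<bullet> x \<le> x \<bullet> rank_one_down ?Q (y i) r x" for x
      using that frame_rest_nonneg[of x y "insert i T"] c
      by (simp add: rank_one_down_perturbed[OF i] perturbed_def inner_add_right inner_commute[of x "y i"]
          mult.assoc power2_eq_square[symmetric])
    then show ?thesis
      by (simp add: above_identity_def self_adjoint_rank_one_down self_adjoint_perturbed)
  qed
  have ins: "rank_one_down ?Q (y i) c = perturbed y c (insert i T)"
    by (rule ext) (simp add: rank_one_down_perturbed[OF i])
  have Q1: "above_identity ?Q"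
  proof -
    have "rank_one_down ?Q (y i) 0 = ?Q" by (auto simp: rank_one_down_def)
    then show ?thesis using above[of 0] c by simp
  qed
  show ?thesis
  proof (cases "y i = 0")
    case True
    have lin: "linear (?Q ^^ m)"
      by (rule self_adjoint_linear[OF self_adjoint_funpow[OF self_adjoint_perturbed]])
    have "perturbed y c (insert i T) = ?Q"
      using ins True by (auto simp: rank_one_down_def fun_eq_iff)
    then show ?thesis using True linear_0[OF lin]
      by (simp add: potential_def c_def p_def)
  next
    case False
    define x where "x = y i \<bullet> y i"
    have x: "0 < x" "x \<le> R" using False R by (auto simp: x_def)
    have "(a * x / (\<theta> * R)) * (1 - exp (- (\<theta> * R))) \<le> 1 - exp (- (a * x))"
      using a x th R by (intro one_minus_exp_ge_chord mult_mono) auto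
    then have "(1 - exp (- (\<theta> * R))) / (\<theta> * R) * a \<le> (1 - exp (- (a * x))) / x"
      using x th R by (simp add: field_simps)
    then have "(1 - exp (- (\<theta> * R))) / (\<theta> * R) * a * (y i \<bullet> (?Q ^^ m) (y i))
        \<le> (1 - exp (- (a * x))) / x * (y i \<bullet> (?Q ^^ m) (y i))"
      by (intro mult_right_mono moment_nonneg[OF Q1])
    moreover have "op_trace (perturbed y c (insert i T) ^^ p)
       \<le> op_trace (?Q ^^ p) - (y i \<bullet> (?Q ^^ m) (y i)) * ((1 - exp (- (a * x))) / x)"
      using op_trace_rank_one_down_le[OF self_adjoint_perturbed False c(1) above, where m = m] c(2)
      by (simp add: ins p_def[symmetric] x_def mult.assoc mult.commute[of "y i \<bullet> y i" c])
         (simp add: mult.assoc[symmetric])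
    ultimately show ?thesis
      by (simp add: potential_def c_def p_def mult.commute)
  qed
qed

text \<open>
  Bernoulli's inequality in homogeneous form.
\<close>
lemma power_diff_ge:
  fixes q e :: real
  assumes "0 < q" "e \<le> q"
  shows "q ^ Suc m - real (Suc m) * e * q ^ m \<le> (q - e) ^ Suc m"
proof -
  have "1 + real (Suc m) * (- e / q) \<le> (1 + (- e / q)) ^ Suc m"
    by (rule Bernoulli_inequality) (use assms in \<open>simp add: field_simps\<close>)
  then have "(1 + real (Suc m) * (- e / q)) * q ^ Suc m \<le> (1 + (- e / q)) ^ Suc m * q ^ Suc m"
    by (rule mult_right_mono) (use assms in simp)
  also have "\<dots> = (q - e) ^ Suc m"
  proof -
    have "(1 + (- e / q)) * q = q - e" using assms by (simp add: field_simps)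
    then show ?thesis by (metis power_mult_distrib)
  qed
  finally show ?thesis using assms by (simp add: algebra_simps)
qed

text \<open>
  Summing the decrease over all remaining \<open>i\<close> produces the trace of \<open>Q\<^sup>m\<close> times the remaining sum of
  outer products, since the indices that can be drawn next are those of that sum. Both are diagonal in
  one eigenbasis, where \<open>power_diff_ge\<close> absorbs the decrease into the parameter \<open>a\<close>.
\<close>
lemma potential_average_insert_le:
  fixes y :: "'i::finite \<Rightarrow> 'a::euclidean_space"
  assumes T: "T \<noteq> UNIV" and a: "0 \<le> a" "a \<le> \<theta>" and R: "\<And>i. y i \<bullet> y i \<le> R" "0 < R" and th: "0 < \<theta>"
  defines "\<gamma> \<equiv> (1 - exp (- (\<theta> * R))) / (\<theta> * R)"
  shows "(\<Sum>i\<in>-T. potential y (Suc m) a (insert i T)) / real (card (- T))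
      \<le> potential y (Suc m) (a * (1 - \<gamma> / real (card (- T)))) T"
proof -
  define N where "N = real (card (- T))"
  have "card (- T) > 0" using T by (auto simp: card_gt_0_iff)
  then have N: "N \<ge> 1" by (simp add: N_def)
  have thR: "\<theta> * R > 0" using th R by simp
  have g: "0 \<le> \<gamma>" using thR by (simp add: \<gamma>_def)
  have "1 - exp (- (\<theta> * R)) \<le> \<theta> * R" using exp_ge_add_one_self[of "- (\<theta> * R)"] by linarith
  then have g1: "\<gamma> \<le> 1" using thR by (simp add: \<gamma>_def)
  obtain B where B: "eigenbasis (frame_rest y T) B"
    using eigenbasis_exists[OF self_adjoint_frame_rest] by blast
  define \<beta> where "\<beta> b = b \<bullet> frame_rest y T b" for b
  define c where "c = a / real (Suc m)"
  have c: "0 \<le> c" "real (Suc m) * c = a" using a by (auto simp: c_def)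
  have \<beta>: "0 \<le> \<beta> b" for b by (simp add: \<beta>_def frame_rest_nonneg)
  have "(\<Sum>i\<in>-T. potential y (Suc m) a (insert i T))
     \<le> (\<Sum>i\<in>-T. potential y (Suc m) a T - \<gamma> * a * (y i \<bullet> (perturbed y c T ^^ m) (y i)))"
    unfolding \<gamma>_def c_def by (intro sum_mono potential_insert_le a R th) auto
  also have "\<dots> = N * potential y (Suc m) a T - \<gamma> * a * (\<Sum>i\<in>-T. y i \<bullet> (perturbed y c T ^^ m) (y i))"
    by (simp add: sum_subtractf sum_distrib_left N_def)
  also have "(\<Sum>i\<in>-T. y i \<bullet> (perturbed y c T ^^ m) (y i)) = (\<Sum>b\<in>B. (1 + c * \<beta> b) ^ m * \<beta> b)"
  proof -
    have "(\<Sum>i\<in>-T. y i \<bullet> (perturbed y c T ^^ m) (y i))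
        = (\<Sum>i\<in>-T. \<Sum>b\<in>B. (1 + c * \<beta> b) ^ m * (y i \<bullet> b)\<^sup>2)"
      by (subst inner_funpow_eigenbasis[OF self_adjoint_perturbed eigenbasis_perturbed(1)[OF B]])
         (auto intro!: sum.cong simp: eigenbasis_perturbed(2)[OF B] \<beta>_def)
    also have "\<dots> = (\<Sum>b\<in>B. (1 + c * \<beta> b) ^ m * \<beta> b)"
      by (subst sum.swap) (simp add: \<beta>_def frame_rest_quadratic sum_distrib_left)
    finally show ?thesis .
  qed
  finally have "(\<Sum>i\<in>-T. potential y (Suc m) a (insert i T)) / N
     \<le> (N * potential y (Suc m) a T - \<gamma> * a * (\<Sum>b\<in>B. (1 + c * \<beta> b) ^ m * \<beta> b)) / N"
    using N by (intro divide_right_mono) auto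
  also have "\<dots> = potential y (Suc m) a T - \<gamma> * a / N * (\<Sum>b\<in>B. (1 + c * \<beta> b) ^ m * \<beta> b)"
    using N by (simp add: diff_divide_distrib)
  also have "\<dots> = (\<Sum>b\<in>B. (1 + c * \<beta> b) ^ Suc m - real (Suc m) * (\<gamma> * c * \<beta> b / N) * (1 + c * \<beta> b) ^ m)"
    unfolding potential_eigenbasis[OF B] c_def[symmetric] \<beta>_def[symmetric] sum_distrib_left sum_subtractf
    by (intro arg_cong2[where f = "(-)"] sum.cong refl) (simp add: c(2)[symmetric] mult_ac)
  also have "\<dots> \<le> (\<Sum>b\<in>B. (1 + c * \<beta> b - \<gamma> * c * \<beta> b / N) ^ Suc m)"
  proof (intro sum_mono power_diff_ge)
    fix b
    show "0 < 1 + c * \<beta> b" using c \<beta>[of b] by (simp add: add_pos_nonneg)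
    have "\<gamma> / N \<le> 1" using g g1 N by (simp add: field_simps)
    then have "(\<gamma> / N) * (c * \<beta> b) \<le> 1 * (c * \<beta> b)" using c \<beta>[of b] by (intro mult_right_mono) auto
    then show "\<gamma> * c * \<beta> b / N \<le> 1 + c * \<beta> b" by (simp add: mult_ac)
  qed
  also have "\<dots> = potential y (Suc m) (a * (1 - \<gamma> / N)) T"
    unfolding potential_eigenbasis[OF B] \<beta>_def[symmetric]
    by (intro sum.cong refl arg_cong[where f = "\<lambda>x. x ^ Suc m"]) (simp add: c_def field_simps del: of_nat_Suc)
  finally show ?thesis by (simp add: N_def)
qed

text \<open>
  Before any draw \<open>frame_rest y {}\<close> is the projection itself, with eigenvalues 0 and 1.
\<close>
lemma potential_empty_projection:
  fixes y :: "'i::finite \<Rightarrow> 'a::euclidean_space"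
  assumes proj: "\<And>x. frame_rest y {} (frame_rest y {} x) = frame_rest y {} x"
  shows "potential y p a {} = real DIM('a) + op_trace (frame_rest y {}) * ((1 + a / real p) ^ p - 1)"
proof -
  let ?P = "frame_rest y {}"
  obtain B where B: "eigenbasis ?P B" using eigenbasis_exists[OF self_adjoint_frame_rest] by blast
  have P: "linear ?P" by (rule self_adjoint_linear[OF self_adjoint_frame_rest])
  have \<beta>: "b \<bullet> ?P b = 0 \<or> b \<bullet> ?P b = 1" if b: "b \<in> B" for b
  proof -
    have e: "?P b = (b \<bullet> ?P b) *\<^sub>R b" using B b by (auto simp: eigenbasis_def)
    have "b \<bullet> ?P b = b \<bullet> ?P (?P b)" by (simp add: proj)
    also have "\<dots> = b \<bullet> ?P ((b \<bullet> ?P b) *\<^sub>R b)" using e by simp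
    also have "\<dots> = (b \<bullet> ?P b) * (b \<bullet> ?P b)" by (simp only: linear_scale[OF P] inner_scaleR_right)
    finally show ?thesis by simp
  qed
  have "potential y p a {} = (\<Sum>b\<in>B. (1 + a / real p * (b \<bullet> ?P b)) ^ p)"
    by (rule potential_eigenbasis[OF B])
  also have "\<dots> = (\<Sum>b\<in>B. 1 + (b \<bullet> ?P b) * ((1 + a / real p) ^ p - 1))"
  proof (intro sum.cong refl)
    fix b assume "b \<in> B"
    from \<beta>[OF this] show "(1 + a / real p * (b \<bullet> ?P b)) ^ p = 1 + (b \<bullet> ?P b) * ((1 + a / real p) ^ p - 1)"
      by (elim disjE) (simp_all only: mult_zero_right mult_zero_left mult_1_left mult_1_right power_one, auto)
  qed
  also have "\<dots> = real (card B) + op_trace ?P * ((1 + a / real p) ^ p - 1)"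
    using B by (simp add: sum.distrib sum_distrib_right eigenbasis_def
        op_trace_orthonormal[OF self_adjoint_frame_rest, of B])
  finally show ?thesis by (simp add: card_eigenbasis[OF B])
qed

lemma op_trace_frame_rest: "op_trace (frame_rest y T) = (\<Sum>i\<in>-T. y i \<bullet> y i)"
  unfolding op_trace_def frame_rest_quadratic
  by (subst sum.swap) (simp add: euclidean_inner[of "y _" "y _"] power2_eq_square)

lemma potential_ge_DIM:
  fixes y :: "'i::finite \<Rightarrow> 'a::euclidean_space"
  assumes a: "0 \<le> a"
  shows "real DIM('a) \<le> potential y p a T"
proof -
  obtain B where B: "eigenbasis (frame_rest y T) B" using eigenbasis_exists[OF self_adjoint_frame_rest] by blast
  have "real DIM('a) = (\<Sum>b\<in>B. 1)" using card_eigenbasis[OF B] by simp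
  also have "\<dots> \<le> potential y p a T"
    unfolding potential_eigenbasis[OF B]
    using a by (intro sum_mono one_le_power) (auto intro!: divide_nonneg_nonneg mult_nonneg_nonneg frame_rest_nonneg)
  finally show ?thesis .
qed

text \<open>
  A large value of the form forces one large eigenvalue. The other eigenvalues of the perturbed
  operator are at least 1.
\<close>
lemma potential_ge_of_quadratic_form:
  fixes y :: "'i::finite \<Rightarrow> 'a::euclidean_space"
  assumes a: "0 \<le> a" and c: "0 \<le> c" and z: "c * (z \<bullet> z) < z \<bullet> frame_rest y T z"
  shows "real DIM('a) - 1 + (1 + a * c / real p) ^ p \<le> potential y p a T"
proof -
  obtain B where B: "eigenbasis (frame_rest y T) B" using eigenbasis_exists[OF self_adjoint_frame_rest] by blast
  have fB: "finite B" using B orthonormal_finite by (auto simp: eigenbasis_def)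
  define \<beta> where "\<beta> b = b \<bullet> frame_rest y T b" for b
  have "\<exists>b\<in>B. c < \<beta> b"
  proof (rule ccontr)
    assume "\<not> (\<exists>b\<in>B. c < \<beta> b)"
    then have "(\<Sum>b\<in>B. \<beta> b * (z \<bullet> b)\<^sup>2) \<le> (\<Sum>b\<in>B. c * (z \<bullet> b)\<^sup>2)"
      by (intro sum_mono mult_right_mono) (auto simp: not_less)
    moreover have "z \<bullet> frame_rest y T z = (\<Sum>b\<in>B. \<beta> b * (z \<bullet> b)\<^sup>2)"
      using inner_funpow_eigenbasis[OF self_adjoint_frame_rest B, of z 1] by (simp add: \<beta>_def)
    moreover have "z \<bullet> z = (\<Sum>b\<in>B. (z \<bullet> b)\<^sup>2)"
      using inner_funpow_eigenbasis[OF self_adjoint_frame_rest B, of z 0] by simp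
    ultimately show False using z by (simp add: sum_distrib_left)
  qed
  then obtain b where b: "b \<in> B" "c < \<beta> b" by blast
  have term_ge: "1 \<le> (1 + a / real p * \<beta> b) ^ p" for b
    using a by (intro one_le_power) (auto simp: \<beta>_def intro!: divide_nonneg_nonneg mult_nonneg_nonneg frame_rest_nonneg)
  have "real DIM('a) - 1 = (\<Sum>b\<in>B - {b}. 1)"
    using card_eigenbasis[OF B] fB b(1) by (simp add: card_Diff_singleton of_nat_diff)
  also have "\<dots> \<le> (\<Sum>b\<in>B - {b}. (1 + a / real p * \<beta> b) ^ p)" by (intro sum_mono term_ge)
  finally have "real DIM('a) - 1 \<le> (\<Sum>b\<in>B - {b}. (1 + a / real p * \<beta> b) ^ p)" .
  moreover have "(1 + a * c / real p) ^ p \<le> (1 + a / real p * \<beta> b) ^ p"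
    using a c b by (intro power_mono add_mono) (auto simp: divide_right_mono mult_left_mono)
  moreover have "potential y p a T = (1 + a / real p * \<beta> b) ^ p + (\<Sum>b\<in>B - {b}. (1 + a / real p * \<beta> b) ^ p)"
    unfolding potential_eigenbasis[OF B] \<beta>_def[symmetric] using fB b(1) by (rule sum.remove)
  ultimately show ?thesis by linarith
qed

section \<open>A matrix Chernoff bound for sampling without replacement\<close>

definition subset_mean :: "nat \<Rightarrow> ('i::finite set \<Rightarrow> real) \<Rightarrow> real" where
  "subset_mean j F = (\<Sum>T | card T = j. F T) / real (CARD('i) choose j)"

lemma subset_mean_mono:
  fixes F G :: "'i::finite set \<Rightarrow> real"
  assumes "\<And>T. card T = j \<Longrightarrow> F T \<le> G T"
  shows "subset_mean j F \<le> subset_mean j G"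
  unfolding subset_mean_def using assms by (intro divide_right_mono sum_mono) auto

text \<open>
  A uniform set of size \<open>j + 1\<close> arises by adding a uniform new element to a uniform set of size \<open>j\<close>:
  double counting of pairs of such a set and one of its elements.
\<close>
lemma subset_mean_Suc:
  fixes F :: "'i::finite set \<Rightarrow> real"
  assumes "j < CARD('i)"
  shows "subset_mean (Suc j) F = subset_mean j (\<lambda>T. (\<Sum>i\<in>-T. F (insert i T)) / real (card (- T)))"
proof -
  define n where "n = CARD('i)"
  have "(\<Sum>T | card T = j. \<Sum>i\<in>-T. F (insert i T))
      = (\<Sum>(T, i)\<in>(SIGMA T:{T. card T = j}. -T). F (insert i T))"
    by (rule sum.Sigma) auto
  also have "\<dots> = (\<Sum>(U, i)\<in>(SIGMA U:{U. card U = Suc j}. U). F U)"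
    by (rule sum.reindex_bij_witness[where i = "\<lambda>(U, i). (U - {i}, i)" and j = "\<lambda>(T, i). (insert i T, i)"])
       (auto simp: insert_absorb card_Diff_singleton)
  also have "\<dots> = (\<Sum>U | card U = Suc j. \<Sum>i\<in>U. F U)"
    by (rule sum.Sigma[symmetric]) auto
  also have "\<dots> = real (Suc j) * (\<Sum>U | card U = Suc j. F U)"
    by (simp add: sum_distrib_left)
  finally have swap: "(\<Sum>T | card T = j. \<Sum>i\<in>-T. F (insert i T)) = real (Suc j) * (\<Sum>U | card U = Suc j. F U)" .
  have "real (Suc j) * real (n choose Suc j) = real (n - j) * real (n choose j)"
    by (metis binomial_absorb_comp binomial_absorption mult.commute of_nat_mult)
  moreover have "n - j > 0" "(n choose j) > 0" "(n choose Suc j) > 0" using assms by (auto simp: n_def)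
  ultimately have *: "real (Suc j) / (real (n - j) * real (n choose j)) = 1 / real (n choose Suc j)"
    by (simp add: field_simps del: of_nat_Suc)
  have "subset_mean j (\<lambda>T. (\<Sum>i\<in>-T. F (insert i T)) / real (card (- T)))
      = (\<Sum>T | card T = j. (\<Sum>i\<in>-T. F (insert i T)) / real (n - j)) / real (n choose j)"
    unfolding subset_mean_def n_def
    by (intro arg_cong2[where f = "(/)"] sum.cong) (auto simp: Compl_eq_Diff_UNIV card_Diff_subset)
  also have "\<dots> = real (Suc j) / (real (n - j) * real (n choose j)) * (\<Sum>U | card U = Suc j. F U)"
    by (simp add: sum_divide_distrib[symmetric] swap)
  also have "\<dots> = subset_mean (Suc j) F"
    unfolding * by (simp add: subset_mean_def n_def)
  finally show ?thesis ..
qed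

lemma subset_mean_zero: "subset_mean 0 F = F {}"
proof -
  have "{T :: 'a set. card T = 0} = {{}}" by auto
  then show ?thesis by (simp add: subset_mean_def)
qed

text \<open>
  Averaging over the draw number \<open>j + 1\<close> multiplies the parameter \<open>a\<close> by \<open>1 - \<gamma> / (n - j)\<close>. The schedule
  is a closed form that dominates this backward recursion from \<open>\<theta>\<close> at \<open>j = l\<close> down to \<open>j = 0\<close>. For \<open>\<gamma> = 1\<close> it solves the
  recursion exactly, with \<open>\<theta> (n - l) / (n - j)\<close>.
\<close>
definition schedule :: "real \<Rightarrow> real \<Rightarrow> nat \<Rightarrow> nat \<Rightarrow> nat \<Rightarrow> real" where
  "schedule \<theta> \<gamma> n l j = \<theta> * (1 - \<gamma> * real (l - j) / real (n - j))"

lemma schedule_bounds: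
  assumes "0 \<le> \<theta>" "0 \<le> \<gamma>" "\<gamma> \<le> 1" "l \<le> n"
  shows "0 \<le> schedule \<theta> \<gamma> n l j" "schedule \<theta> \<gamma> n l j \<le> \<theta>"
proof -
  have "real (l - j) / real (n - j) \<le> 1" using assms by (auto simp: divide_le_eq_1)
  then have "\<gamma> * (real (l - j) / real (n - j)) \<le> 1" using assms by (intro mult_le_one) auto
  then show "0 \<le> schedule \<theta> \<gamma> n l j" using assms by (simp add: schedule_def)
  show "schedule \<theta> \<gamma> n l j \<le> \<theta>"
    using assms by (simp add: schedule_def right_diff_distrib)
qed

lemma schedule_step:
  assumes "0 \<le> \<theta>" "0 \<le> \<gamma>" "\<gamma> \<le> 1" "j < l" "l \<le> n"
  shows "schedule \<theta> \<gamma> n l (Suc j) * (1 - \<gamma> / real (n - j)) \<le> schedule \<theta> \<gamma> n l j"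
proof -
  define m r where "m = real (n - Suc j)" and "r = real (l - Suc j)"
  have m: "real (n - j) = m + 1" and r: "real (l - j) = r + 1"
    using assms by (auto simp: m_def r_def of_nat_diff)
  have rm: "0 \<le> r" "r \<le> m" using assms by (auto simp: m_def r_def)
  have "(1 - \<gamma> * r / m) * (1 - \<gamma> / (m + 1)) \<le> 1 - \<gamma> * (r + 1) / (m + 1)"
  proof (cases "m = 0")
    case True
    then show ?thesis using rm by simp
  next
    case False
    then have m0: "m > 0" using rm by simp
    have "0 \<le> \<gamma> * r * (1 - \<gamma>) / (m * (m + 1))"
      using assms rm m0 by (intro divide_nonneg_nonneg mult_nonneg_nonneg) auto
    also have "\<dots> = (1 - \<gamma> * (r + 1) / (m + 1)) - (1 - \<gamma> * r / m) * (1 - \<gamma> / (m + 1))"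
      using m0 by (simp add: divide_simps) (simp add: algebra_simps)
    finally show ?thesis by simp
  qed
  then have "\<theta> * ((1 - \<gamma> * r / m) * (1 - \<gamma> / (m + 1))) \<le> \<theta> * (1 - \<gamma> * (r + 1) / (m + 1))"
    using assms by (intro mult_left_mono) auto
  then show ?thesis by (simp add: schedule_def m r m_def[symmetric] r_def[symmetric] mult.assoc)
qed

lemma potential_mean_le:
  fixes y :: "'i::finite \<Rightarrow> 'a::euclidean_space"
  assumes R: "\<And>i. y i \<bullet> y i \<le> R" "0 < R" and th: "0 < \<theta>" and l: "l \<le> CARD('i)"
  defines "\<gamma> \<equiv> (1 - exp (- (\<theta> * R))) / (\<theta> * R)"
  shows "subset_mean l (potential y (Suc m) \<theta>) \<le> potential y (Suc m) (\<theta> * (1 - \<gamma> * real l / real CARD('i))) {}"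
proof -
  have thR: "\<theta> * R > 0" using th R by simp
  have g: "0 \<le> \<gamma>" using thR by (simp add: \<gamma>_def)
  have "1 - exp (- (\<theta> * R)) \<le> \<theta> * R" using exp_ge_add_one_self[of "- (\<theta> * R)"] by linarith
  then have g1: "\<gamma> \<le> 1" using thR by (simp add: \<gamma>_def)
  let ?a = "schedule \<theta> \<gamma> CARD('i) l"
  have "subset_mean j (potential y (Suc m) (?a j)) \<le> potential y (Suc m) (?a 0) {}" if "j \<le> l" for j
    using that
  proof (induction j)
    case 0
    then show ?case by (simp add: subset_mean_zero)
  next
    case (Suc j)
    have a: "0 \<le> ?a (Suc j)" "?a (Suc j) \<le> \<theta>"
      using schedule_bounds th g g1 l by auto
    have "subset_mean (Suc j) (potential y (Suc m) (?a (Suc j)))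
        = subset_mean j (\<lambda>T. (\<Sum>i\<in>-T. potential y (Suc m) (?a (Suc j)) (insert i T)) / real (card (- T)))"
      using Suc.prems l by (intro subset_mean_Suc) auto
    also have "\<dots> \<le> subset_mean j (potential y (Suc m) (?a j))"
    proof (rule subset_mean_mono)
      fix T :: "'i set" assume T: "card T = j"
      have cT: "card (- T) = CARD('i) - j" by (simp add: Compl_eq_Diff_UNIV card_Diff_subset T)
      have "T \<noteq> UNIV" using T Suc.prems l by auto
      from potential_average_insert_le[OF this a R th, where m = m]
      have "(\<Sum>i\<in>-T. potential y (Suc m) (?a (Suc j)) (insert i T)) / real (card (- T))
        \<le> potential y (Suc m) (?a (Suc j) * (1 - \<gamma> / real (CARD('i) - j))) T"
        by (simp add: \<gamma>_def cT)
      also have "\<dots> \<le> potential y (Suc m) (?a j) T"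
      proof (rule potential_mono)
        have "real (CARD('i) - j) \<ge> 1" using Suc.prems l by auto
        then have "\<gamma> / real (CARD('i) - j) \<le> 1"
          using g1 by (subst pos_divide_le_eq) linarith+
        then show "0 \<le> ?a (Suc j) * (1 - \<gamma> / real (CARD('i) - j))" using a by simp
        show "?a (Suc j) * (1 - \<gamma> / real (CARD('i) - j)) \<le> ?a j"
          using Suc.prems l th g g1 by (intro schedule_step) auto
      qed
      finally show "(\<Sum>i\<in>-T. potential y (Suc m) (?a (Suc j)) (insert i T)) / real (card (- T))
        \<le> potential y (Suc m) (?a j) T" .
    qed
    also have "\<dots> \<le> potential y (Suc m) (?a 0) {}" using Suc by simp
    finally show ?case .
  qed
  from this[of l] show ?thesis by (simp add: schedule_def)
qed

text \<open>
  When the outer products of the \<open>y i\<close> sum to a projection, this says that the sum over \<open>T\<close> has an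
  eigenvalue below \<open>t\<close> on the range of that projection.
\<close>
definition ill_conditioned :: "('i::finite \<Rightarrow> 'a::euclidean_space) \<Rightarrow> real \<Rightarrow> 'i set \<Rightarrow> bool" where
  "ill_conditioned y t T \<longleftrightarrow> (\<exists>z. frame_rest y {} z = z \<and> (\<Sum>i\<in>T. (y i \<bullet> z)\<^sup>2) < t * (z \<bullet> z))"

text \<open>
  Markov's inequality for the potential, with its constant part \<open>DIM('a) - k\<close> removed: that is the
  contribution of the complement of the range of the projection. An ill-conditioned \<open>T\<close> leaves a
  direction in which the remaining sum exceeds \<open>1 - t\<close>.
\<close>
lemma ill_conditioned_fraction_power_le:
  fixes y :: "'i::finite \<Rightarrow> 'a::euclidean_space" and m :: nat
  assumes proj: "\<And>x. frame_rest y {} (frame_rest y {} x) = frame_rest y {} x"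
    and k: "(\<Sum>i\<in>UNIV. y i \<bullet> y i) = k" "1 \<le> k"
    and R: "\<And>i. y i \<bullet> y i \<le> R" "0 < R" and th: "0 < \<theta>" and t: "t \<le> 1" and l: "l \<le> CARD('i)"
  defines "a0 \<equiv> \<theta> * (1 - (1 - exp (- (\<theta> * R))) / (\<theta> * R) * real l / real CARD('i))"
  shows "subset_mean l (\<lambda>T. of_bool (ill_conditioned y t T)) * (1 + \<theta> * (1 - t) / real (Suc m)) ^ Suc m
     \<le> k * (1 + a0 / real (Suc m)) ^ Suc m"
proof -
  let ?q = "(1 + \<theta> * (1 - t) / real (Suc m)) ^ Suc m"
  let ?D = "real DIM('a)"
  have k': "op_trace (frame_rest y {}) = k" by (simp add: op_trace_frame_rest k)
  have "?D - k + of_bool (ill_conditioned y t T) * ?q \<le> potential y (Suc m) \<theta> T" for T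
  proof (cases "ill_conditioned y t T")
    case True
    then obtain z where z: "frame_rest y {} z = z" "(\<Sum>i\<in>T. (y i \<bullet> z)\<^sup>2) < t * (z \<bullet> z)"
      by (auto simp: ill_conditioned_def)
    have "z \<bullet> z = (\<Sum>i\<in>UNIV. (y i \<bullet> z)\<^sup>2)"
      using frame_rest_quadratic[of z y "{}"] z(1) by simp
    also have "\<dots> = (\<Sum>i\<in>T. (y i \<bullet> z)\<^sup>2) + z \<bullet> frame_rest y T z"
      unfolding frame_rest_quadratic by (subst sum.union_disjoint[symmetric]) (auto intro: sum.cong)
    finally have "(1 - t) * (z \<bullet> z) < z \<bullet> frame_rest y T z"
      using z(2) by (simp add: algebra_simps)
    from potential_ge_of_quadratic_form[OF _ _ this, of \<theta> "Suc m"]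
    show ?thesis using th t k True by simp
  next
    case False
    then show ?thesis using potential_ge_DIM[of \<theta> y "Suc m" T] th k by simp
  qed
  then have "subset_mean l (\<lambda>T. ?D - k + of_bool (ill_conditioned y t T) * ?q) \<le> subset_mean l (potential y (Suc m) \<theta>)"
    by (intro subset_mean_mono)
  also have "\<dots> \<le> potential y (Suc m) a0 {}"
    unfolding a0_def by (rule potential_mean_le[OF R th l])
  also have "\<dots> = ?D + k * ((1 + a0 / real (Suc m)) ^ Suc m - 1)"
    unfolding potential_empty_projection[OF proj] k' ..
  finally have *: "subset_mean l (\<lambda>T. ?D - k + of_bool (ill_conditioned y t T) * ?q)
    \<le> ?D - k + k * (1 + a0 / real (Suc m)) ^ Suc m" by (simp add: algebra_simps)
  have "card {T :: 'i set. card T = l} = CARD('i) choose l"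
    using n_subsets[of "UNIV :: 'i set" l] by simp
  moreover have "CARD('i) choose l > 0" using l by simp
  ultimately have "subset_mean l (\<lambda>T. ?D - k + of_bool (ill_conditioned y t T) * ?q)
     = ?D - k + subset_mean l (\<lambda>T. of_bool (ill_conditioned y t T)) * ?q"
    by (simp add: subset_mean_def sum.distrib sum_distrib_right add_divide_distrib del: power_Suc)
  with * show ?thesis by linarith
qed

text \<open>
  Lower tail for the smallest eigenvalue of a sum of rank-one operators drawn without replacement.
  The left-hand side is the fraction of ill-conditioned \<open>l\<close>-subsets. Both \<open>p\<close>-th powers of
  \<open>ill_conditioned_fraction_power_le\<close> tend to exponentials.
\<close>
theorem matrix_Chernoff_without_replacement:
  fixes y :: "'i::finite \<Rightarrow> 'a::euclidean_space"
  assumes proj: "\<And>x. frame_rest y {} (frame_rest y {} x) = frame_rest y {} x"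
    and k: "(\<Sum>i\<in>UNIV. y i \<bullet> y i) = k" "1 \<le> k"
    and R: "\<And>i. y i \<bullet> y i \<le> R" "0 < R" and th: "0 < \<theta>" and t: "t \<le> 1" and l: "l \<le> CARD('i)"
  shows "subset_mean l (\<lambda>T. of_bool (ill_conditioned y t T))
     \<le> k * exp (\<theta> * t - (1 - exp (- (\<theta> * R))) / R * (real l / real CARD('i)))"
proof -
  define f where "f = subset_mean l (\<lambda>T. of_bool (ill_conditioned y t T))"
  define a0 where "a0 = \<theta> * (1 - (1 - exp (- (\<theta> * R))) / (\<theta> * R) * real l / real CARD('i))"
  have lim: "(\<lambda>m. (1 + x / real (Suc m)) ^ Suc m) \<longlonglongrightarrow> exp x" for x
    using LIMSEQ_Suc[OF tendsto_exp_limit_sequentially[of x]] .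
  have "f * exp (\<theta> * (1 - t)) \<le> k * exp a0"
  proof (rule LIMSEQ_le)
    show "(\<lambda>m. f * (1 + \<theta> * (1 - t) / real (Suc m)) ^ Suc m) \<longlonglongrightarrow> f * exp (\<theta> * (1 - t))"
      by (intro tendsto_mult tendsto_const lim)
    show "(\<lambda>m. k * (1 + a0 / real (Suc m)) ^ Suc m) \<longlonglongrightarrow> k * exp a0"
      by (intro tendsto_mult tendsto_const lim)
    show "\<exists>N. \<forall>m\<ge>N. f * (1 + \<theta> * (1 - t) / real (Suc m)) ^ Suc m \<le> k * (1 + a0 / real (Suc m)) ^ Suc m"
      unfolding f_def a0_def
      using ill_conditioned_fraction_power_le[OF proj k R th t l] by blast
  qed
  then have "f \<le> k * exp a0 / exp (\<theta> * (1 - t))"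
    by (subst pos_le_divide_eq) auto
  also have "\<dots> = k * exp (a0 - \<theta> * (1 - t))"
    by (simp only: exp_diff times_divide_eq_right)
  also have "a0 - \<theta> * (1 - t) = \<theta> * t - (1 - exp (- (\<theta> * R))) / R * (real l / real CARD('i))"
    using th R by (simp add: a0_def field_simps)
  finally show ?thesis by (simp add: f_def)
qed

section \<open>Ordered eigenvalues of a symmetric matrix\<close>

lemma self_adjoint_matrix:
  fixes A :: "real^'n^'n"
  assumes "transpose A = A"
  shows "self_adjoint ((*v) A)"
  unfolding self_adjoint_def
proof (intro conjI allI)
  show "linear ((*v) A)" by (rule matrix_vector_mul_linear)
  show "(A *v x) \<bullet> y = x \<bullet> (A *v y)" for x y
    using dot_lmul_matrix[of x A y] transpose_matrix_vector[of A x] assms by simp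
qed

definition const_poly_matrix :: "real^'n^'m \<Rightarrow> real poly^'n^'m" where
  "const_poly_matrix A = (\<chi> i j. [:A $ i $ j:])"

lemma const_poly_sum: "(\<Sum>x\<in>S. [:f x:]) = [:sum f S:]"
  by (induction S rule: infinite_finite_induct) auto

lemma const_poly_matrix_mult:
  "const_poly_matrix (A ** B) = const_poly_matrix A ** const_poly_matrix B"
  by (simp add: const_poly_matrix_def matrix_matrix_mult_def const_poly_sum[symmetric] vec_eq_iff mult.commute)

lemma const_poly_matrix_one: "const_poly_matrix (mat 1) = mat 1"
  by (simp add: const_poly_matrix_def mat_def vec_eq_iff one_pCons)

lemma mat_mult_commute:
  fixes M :: "'a::comm_semiring_1^'n^'n"
  shows "M ** mat c = mat c ** M"
  by (simp add: matrix_matrix_mult_def mat_def vec_eq_iff if_distrib if_distribR mult.commute cong: if_cong)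

lemma matrix_diff_mult_distrib:
  fixes A B :: "'a::comm_ring_1^'n^'m" and D :: "'a^'p^'n"
  shows "(A - B) ** D = A ** D - B ** D"
  by (simp add: matrix_matrix_mult_def vec_eq_iff left_diff_distrib sum_subtractf)

lemma matrix_mult_diff_distrib:
  fixes A B :: "'a::comm_ring_1^'n^'m" and D :: "'a^'m^'p"
  shows "D ** (A - B) = D ** A - D ** B"
  by (simp add: matrix_matrix_mult_def vec_eq_iff right_diff_distrib sum_subtractf)

text \<open>
  Conjugation by the orthogonal matrix of the eigenbasis diagonalizes the matrix over the
  polynomial ring as well, and does not change the determinant: \<open>det V * det (V\<^sup>t) = 1\<close>.
\<close>
lemma proots_charpoly:
  fixes A :: "real^'n^'n"
  assumes A: "transpose A = A" and B: "eigenbasis ((*v) A) B"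
  shows "proots (charpoly A) = image_mset (\<lambda>b. b \<bullet> (A *v b)) (mset_set B)"
proof -
  let ?d = "\<lambda>b. b \<bullet> (A *v b)"
  have oB: "orthonormal B" using B by (simp add: eigenbasis_def)
  have fB: "finite B" by (rule orthonormal_finite[OF oB])
  have "card B = CARD('n)" using card_eigenbasis[OF B] by simp
  then obtain h :: "'n \<Rightarrow> real^'n" where h: "bij_betw h UNIV B"
    using finite_same_card_bij[OF _ fB, of "UNIV :: 'n set"] by auto
  have hB: "h i \<in> B" for i using h by (auto simp: bij_betw_def)
  have hh: "h i \<bullet> h j = (if i = j then 1 else 0)" for i j
    using oB hB h by (auto simp: orthonormal_def bij_betw_def inj_def)
  define V :: "real^'n^'n" where "V = (\<chi> i j. h i $ j)"
  have VV: "V ** transpose V = mat 1"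
    by (simp add: V_def matrix_matrix_mult_def transpose_def mat_def vec_eq_iff hh[unfolded inner_vec_def, simplified])
  have VAV: "(V ** A ** transpose V) $ i $ j = (if i = j then ?d (h i) else 0)" for i j
  proof -
    have "(V ** A ** transpose V) $ i $ j = h i \<bullet> (A *v h j)"
      by (simp add: V_def matrix_mul_assoc[symmetric])
         (simp add: matrix_matrix_mult_def matrix_vector_mult_def transpose_def inner_vec_def)
    also have "\<dots> = ?d (h j) * (h i \<bullet> h j)"
      using B hB[of j] unfolding eigenbasis_def by (metis inner_scaleR_right)
    finally show ?thesis by (simp add: hh)
  qed
  let ?X = "mat [:0, 1:] :: real poly^'n^'n"
  let ?V = "const_poly_matrix V" and ?V' = "const_poly_matrix (transpose V)"
  have V1: "?V ** ?V' = mat 1"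
    by (simp only: const_poly_matrix_mult[symmetric] VV const_poly_matrix_one)
  have "det ?V * det ?V' = 1" by (simp only: det_mul[symmetric] V1 det_I)
  then have "charpoly A = det ?V * charpoly A * det ?V'" by (metis mult.assoc mult.commute mult_1)
  also have "\<dots> = det (?V ** (?X - const_poly_matrix A) ** ?V')"
    by (simp add: charpoly_def const_poly_matrix_def det_mul)
  also have "?V ** (?X - const_poly_matrix A) ** ?V' = ?X - const_poly_matrix (V ** A ** transpose V)"
    by (simp add: matrix_mult_diff_distrib matrix_diff_mult_distrib mat_mult_commute const_poly_matrix_mult)
       (simp add: matrix_mul_assoc[symmetric] V1)
  also have "det \<dots> = (\<Prod>i\<in>UNIV. [:- ?d (h i), 1:])"
    by (subst det_diagonal) (auto simp: mat_def const_poly_matrix_def VAV)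
  also have "\<dots> = (\<Prod>b\<in>B. [:- ?d b, 1:])"
    by (rule prod.reindex_bij_betw[OF h])
  finally have "proots (charpoly A) = (\<Sum>b\<in>B. {#?d b#})"
    by (simp add: proots_prod)
  also have "\<dots> = image_mset ?d (mset_set B)"
    using fB by (induction B rule: finite_induct) auto
  finally show ?thesis .
qed

lemma length_eigenvalues_desc:
  fixes A :: "real^'n^'n"
  assumes A: "transpose A = A"
  shows "length (eigenvalues_desc A) = CARD('n)"
proof -
  obtain B where B: "eigenbasis ((*v) A) B" using eigenbasis_exists[OF self_adjoint_matrix[OF A]] by blast
  have "length (eigenvalues_desc A) = size (mset (eigenvalues_desc A))" by (simp only: size_mset)
  also have "mset (eigenvalues_desc A) = proots (charpoly A)" by (simp add: eigenvalues_desc_def)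
  also have "size \<dots> = CARD('n)" using card_eigenbasis[OF B] by (simp add: proots_charpoly[OF A B])
  finally show ?thesis .
qed

lemma eigval_nonneg:
  fixes A :: "real^'n^'n"
  assumes "positive_semidefinite A"
  shows "0 \<le> eigval A j"
proof (cases "1 \<le> j \<and> j \<le> length (eigenvalues_desc A)")
  case True
  have A: "transpose A = A" using assms by (simp add: positive_semidefinite_def)
  obtain B where B: "eigenbasis ((*v) A) B" using eigenbasis_exists[OF self_adjoint_matrix[OF A]] by blast
  have "eigval A j \<in># mset (eigenvalues_desc A)" using True by (auto simp: eigval_def)
  also have "mset (eigenvalues_desc A) = image_mset (\<lambda>b. b \<bullet> (A *v b)) (mset_set B)"
    by (simp add: eigenvalues_desc_def proots_charpoly[OF A B])
  finally show ?thesis using assms by (auto simp: positive_semidefinite_def)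
qed (auto simp: eigval_def)

text \<open>
  The vectors \<open>u\<close> extend to an eigenbasis. Its eigenvalues are those of the characteristic
  polynomial with multiplicity, and the \<open>u i\<close> use up the first \<open>k\<close> of them. The multiset of the remaining ones
  is therefore the tail of the decreasing list, whatever ties there are.
\<close>
lemma quadratic_form_le_next_eigval:
  fixes A :: "real^'n^'n"
  assumes A: "transpose A = A" and k: "k \<le> CARD('n)"
    and on: "\<forall>i\<in>{1..k}. \<forall>j\<in>{1..k}. u i \<bullet> u j = (if i = j then 1 else 0)"
    and ev: "\<forall>i\<in>{1..k}. A *v u i = eigval A i *\<^sub>R u i"
    and x: "\<forall>i\<in>{1..k}. u i \<bullet> x = 0"
  shows "x \<bullet> (A *v x) \<le> eigval A (k + 1) * (x \<bullet> x)"
proof -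
  define U where "U = u ` {1..k}"
  define W where "W = {x. \<forall>i\<in>{1..k}. u i \<bullet> x = 0}"
  let ?d = "\<lambda>b. b \<bullet> (A *v b)"
  note sa = self_adjoint_matrix[OF A]
  have "inj_on u {1..k}"
    using on by (intro inj_onI) (metis zero_neq_one)
  then have mU: "mset_set U = image_mset u (mset_set {1..k})"
    by (simp add: U_def image_mset_mset_set)
  have oU: "orthonormal U"
    using on \<open>inj_on u {1..k}\<close> by (auto simp: orthonormal_def U_def inj_on_eq_iff)
  have W: "subspace W"
    by (auto simp: W_def subspace_def inner_add_right)
  have AW: "A *v x \<in> W" if "x \<in> W" for x
    using that self_adjointD[OF sa, of "u _" x, symmetric] ev by (auto simp: W_def)
  obtain C where C: "orthonormal C" "span C = W" "\<forall>b\<in>C. A *v b = ?d b *\<^sub>R b"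
    using spectral_theorem[OF sa W AW] by blast
  have UC: "b \<bullet> c = 0" if "b \<in> U" "c \<in> C" for b c
    using that C(2) span_base[of c C] by (auto simp: W_def U_def)
  have disj: "U \<inter> C = {}"
    using UC oU by (force simp: orthonormal_def)
  have oB: "orthonormal (U \<union> C)"
  proof -
    have "b \<bullet> c = 0" "c \<bullet> b = 0" "b \<noteq> c" if "b \<in> U" "c \<in> C" for b c
      using UC[OF that] disj that inner_commute[of c b] by auto
    then show ?thesis using oU C(1) unfolding orthonormal_def by (metis Un_iff)
  qed
  have "span (U \<union> C) = UNIV"
  proof (rule UNIV_eq_I[symmetric])
    fix v
    define p where "p = (\<Sum>b\<in>U. (v \<bullet> b) *\<^sub>R b)"
    have "p \<in> span U" unfolding p_def by (intro span_sum span_scale span_base)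
    moreover have "v - p \<in> W"
    proof -
      have "b \<bullet> p = b \<bullet> v" if "b \<in> U" for b
      proof -
        have "b \<bullet> p = (\<Sum>b'\<in>U. if b' = b then v \<bullet> b else 0)"
          unfolding p_def inner_sum_right using oU that
          by (intro sum.cong refl) (auto simp: orthonormal_def)
        then show ?thesis using that orthonormal_finite[OF oU] by (simp add: inner_commute)
      qed
      then show ?thesis by (auto simp: W_def U_def inner_diff_right)
    qed
    ultimately have "p + (v - p) \<in> span (U \<union> C)"
      using C(2) span_mono[of U "U \<union> C"] span_mono[of C "U \<union> C"] by (intro span_add) auto
    then show "v \<in> span (U \<union> C)" by simp
  qed
  moreover have dU: "?d (u i) = eigval A i" if "i \<in> {1..k}" for i
    using that on ev by auto
  then have "\<forall>b\<in>U. A *v b = ?d b *\<^sub>R b" using ev by (auto simp: U_def)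
  ultimately have B: "eigenbasis ((*v) A) (U \<union> C)"
    using oB C(3) by (auto simp: eigenbasis_def)
  define L where "L = eigenvalues_desc A"
  have len: "length L = CARD('n)" unfolding L_def by (rule length_eigenvalues_desc[OF A])
  have "mset L = image_mset ?d (mset_set (U \<union> C))"
    by (simp add: L_def eigenvalues_desc_def proots_charpoly[OF A B])
  also have "\<dots> = image_mset ?d (mset_set U) + image_mset ?d (mset_set C)"
    using disj orthonormal_finite[OF oU] orthonormal_finite[OF C(1)] by (simp add: mset_set_Union)
  also have "image_mset ?d (mset_set U) = image_mset (eigval A) (mset_set {1..k})"
    unfolding mU multiset.map_comp by (rule image_mset_cong) (use dU in auto)
  also have "\<dots> = mset (map (eigval A) [1..<Suc k])"
    by (metis atLeastLessThanSuc_atLeastAtMost mset_map mset_upt)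
  also have "map (eigval A) [1..<Suc k] = take k L"
    using k len by (intro nth_equalityI) (auto simp: eigval_def L_def[symmetric] nth_upt simp del: upt_Suc)
  finally have "mset (take k L) + mset (drop k L) = mset (take k L) + image_mset ?d (mset_set C)"
    by (metis append_take_drop_id mset_append)
  then have drop: "mset (drop k L) = image_mset ?d (mset_set C)" by simp
  have le: "?d c \<le> eigval A (k + 1)" if "c \<in> C" for c
  proof -
    have "?d c \<in># mset (drop k L)"
      using that orthonormal_finite[OF C(1)] by (simp add: drop)
    then obtain m where m: "m < length (drop k L)" "?d c = drop k L ! m"
      by (metis in_set_conv_nth set_mset_mset)
    then have "?d c = L ! (k + m)" using k len by simp
    also have "\<dots> \<le> L ! k"
      using m(1) by (intro sorted_rev_nth_mono) (auto simp: L_def eigenvalues_desc_def)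
    also have "\<dots> = eigval A (k + 1)" using m(1) by (simp add: eigval_def L_def)
    finally show ?thesis .
  qed
  have xC: "x \<in> span C" using x by (simp add: C(2) W_def)
  have "x \<bullet> (A *v x) = (\<Sum>c\<in>C. ?d c * (x \<bullet> c)\<^sup>2)"
  proof -
    have "(A *v x) \<bullet> c = ?d c * (x \<bullet> c)" if "c \<in> C" for c
      using that C(3) by (metis self_adjointD[OF sa] inner_scaleR_right)
    then show ?thesis
      by (subst orthonormal_inner[OF C(1) xC]) (auto intro!: sum.cong simp: power2_eq_square)
  qed
  also have "\<dots> \<le> (\<Sum>c\<in>C. eigval A (k + 1) * (x \<bullet> c)\<^sup>2)"
    by (intro sum_mono mult_right_mono le) auto
  also have "\<dots> = eigval A (k + 1) * (x \<bullet> x)"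
    by (subst orthonormal_inner[OF C(1) xC, of x]) (simp add: sum_distrib_left power2_eq_square)
  finally show ?thesis .
qed

section \<open>The residual of the Nystroem extension\<close>

text \<open>
  An isotropic vector maximizes the form of \<open>- A\<close>.
\<close>
lemma psd_isotropic_imp_kernel:
  fixes A :: "real^'n^'n"
  assumes A: "positive_semidefinite A" and r: "r \<bullet> (A *v r) = 0"
  shows "A *v r = 0"
proof -
  have "self_adjoint (\<lambda>x. - (A *v x))"
    using self_adjoint_matrix[of A] A
    by (auto simp: positive_semidefinite_def self_adjoint_def linear_compose_neg)
  from Rayleigh_maximizer_eigenvector[OF this subspace_UNIV, of r 0]
  show ?thesis using A r by (auto simp: positive_semidefinite_def)
qed

lemma Penrose_unique:
  fixes W :: "real^'n^'m"
  assumes X: "W ** X ** W = W" "X ** W ** X = X" "transpose (W ** X) = W ** X" "transpose (X ** W) = X ** W"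
    and Y: "W ** Y ** W = W" "Y ** W ** Y = Y" "transpose (W ** Y) = W ** Y" "transpose (Y ** W) = Y ** W"
  shows "X = Y"
proof -
  have "W ** X = transpose (W ** Y ** W ** X)" using X Y by simp
  also have "\<dots> = (W ** X) ** (W ** Y)"
    using X(3) Y(3) by (metis matrix_mul_assoc matrix_transpose_mul)
  also have "\<dots> = W ** Y" using X(1) by (simp add: matrix_mul_assoc)
  finally have WX: "W ** X = W ** Y" .
  have "X ** W = transpose (X ** (W ** Y ** W))" using X Y by simp
  also have "\<dots> = (Y ** W) ** (X ** W)"
    using X(4) Y(4) by (metis matrix_mul_assoc matrix_transpose_mul)
  also have "\<dots> = Y ** W" using X(1) by (simp add: matrix_mul_assoc[symmetric])
  finally have XW: "X ** W = Y ** W" .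
  have "X = X ** W ** X" using X(2) by simp
  also have "\<dots> = Y ** W ** Y" using XW WX by (metis matrix_mul_assoc)
  finally show ?thesis using Y(2) by simp
qed

text \<open>
  Invert the nonzero eigenvalues and keep the zero ones; \<open>inverse 0 = 0\<close> does both at once.
\<close>
lemma symmetric_pinv_exists:
  fixes W :: "real^'l^'l"
  assumes W: "transpose W = W"
  obtains X where "transpose X = X" "W ** X ** W = W" "X ** W ** X = X"
    "transpose (W ** X) = W ** X" "transpose (X ** W) = X ** W"
proof -
  obtain B where B: "eigenbasis ((*v) W) B" using eigenbasis_exists[OF self_adjoint_matrix[OF W]] by blast
  have oB: "orthonormal B" "span B = UNIV" using B by (auto simp: eigenbasis_def)
  have fB: "finite B" by (rule orthonormal_finite[OF oB(1)])
  define d where "d b = b \<bullet> (W *v b)" for b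
  have Wb: "W *v b = d b *\<^sub>R b" if "b \<in> B" for b
    using B that by (auto simp: eigenbasis_def d_def)
  \<comment> \<open>functional calculus: \<open>spec \<phi>\<close> acts on the eigenvector \<open>b\<close> as multiplication by \<open>\<phi> b\<close>\<close>
  define spec :: "(real^'l \<Rightarrow> real) \<Rightarrow> real^'l^'l" where
    "spec \<phi> = (\<chi> i j. \<Sum>b\<in>B. \<phi> b * b $ i * b $ j)" for \<phi>
  have spec_sym: "transpose (spec \<phi>) = spec \<phi>" for \<phi>
    by (simp add: spec_def transpose_def mult_ac)
  have spec_vec: "spec \<phi> *v x = (\<Sum>b\<in>B. (\<phi> b * (x \<bullet> b)) *\<^sub>R b)" for \<phi> x
  proof -
    have "(spec \<phi> *v x) $ i = (\<Sum>b\<in>B. (\<phi> b * (x \<bullet> b)) *\<^sub>R b) $ i" for i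
      unfolding spec_def matrix_vector_mult_def inner_vec_def
      by (simp add: sum_distrib_left sum_distrib_right, subst sum.swap) (simp add: mult_ac)
    then show ?thesis by (simp add: vec_eq_iff)
  qed
  have spec_basis: "spec \<phi> *v b = \<phi> b *\<^sub>R b" if "b \<in> B" for \<phi> b
  proof -
    have "spec \<phi> *v b = (\<Sum>b'\<in>B. if b' = b then \<phi> b *\<^sub>R b else 0)"
      unfolding spec_vec using oB(1) that by (intro sum.cong refl) (auto simp: orthonormal_def)
    then show ?thesis using fB that by simp
  qed
  have eqI: "M = N" if "\<And>b. b \<in> B \<Longrightarrow> M *v b = N *v b" for M N :: "real^'l^'l"
  proof -
    have "M *v x = N *v x" for x
      by (rule linear_eq_on[of "(*v) M" "(*v) N" x B]) (use that oB in auto)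
    then show ?thesis by (simp add: matrix_eq)
  qed
  have W_spec: "W = spec d" by (rule eqI) (simp add: Wb spec_basis)
  have spec_mult: "spec \<phi> ** spec \<psi> = spec (\<lambda>b. \<phi> b * \<psi> b)" for \<phi> \<psi>
    by (rule eqI) (simp add: matrix_vector_mul_assoc[symmetric] spec_basis matrix_vector_mult_scaleR mult.commute)
  have inv: "d b * inverse (d b) * d b = d b" "inverse (d b) * d b * inverse (d b) = inverse (d b)" for b
    by (cases "d b = 0"; simp)+
  show ?thesis
    by (rule that[of "spec (\<lambda>b. inverse (d b))"]) (simp_all only: W_spec spec_mult spec_sym inv)
qed

lemma pinv_symmetric:
  fixes W :: "real^'l^'l"
  assumes W: "transpose W = W"
  shows "transpose (pinv W) = pinv W" "W ** pinv W ** W = W"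
proof -
  obtain X where X: "transpose X = X" "W ** X ** W = W" "X ** W ** X = X"
    "transpose (W ** X) = W ** X" "transpose (X ** W) = X ** W"
    using symmetric_pinv_exists[OF W] by blast
  have "pinv W = X"
    unfolding pinv_def
  proof (rule the_equality)
    fix Y
    assume "W ** Y ** W = W \<and> Y ** W ** Y = Y \<and> transpose (W ** Y) = W ** Y \<and> transpose (Y ** W) = Y ** W"
    then show "Y = X" using Penrose_unique[of W Y X] X(2-5) by blast
  qed (use X(2-5) in blast)
  then show "transpose (pinv W) = pinv W" "W ** pinv W ** W = W" using X by auto
qed

lemma spectral_norm_le_quadratic_form:
  fixes E :: "real^'n^'n"
  assumes E: "positive_semidefinite E" and c: "\<And>x. x \<bullet> (E *v x) \<le> c * (x \<bullet> x)"
  shows "spectral_norm E \<le> c"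
proof -
  have sa: "self_adjoint ((*v) E)"
    using E by (intro self_adjoint_matrix) (simp add: positive_semidefinite_def)
  obtain B where B: "eigenbasis ((*v) E) B" using eigenbasis_exists[OF sa] by blast
  then have oB: "orthonormal B" "span B = UNIV" by (auto simp: eigenbasis_def)
  define d where "d b = b \<bullet> (E *v b)" for b
  have d: "0 \<le> d b" "d b \<le> c" if "b \<in> B" for b
  proof -
    have "b \<bullet> b = 1" using that oB by (auto simp: orthonormal_def)
    then show "0 \<le> d b" "d b \<le> c" using E c[of b] by (auto simp: d_def positive_semidefinite_def)
  qed
  have "B \<noteq> {}" using card_eigenbasis[OF B] by auto
  then have c0: "0 \<le> c" using d by fastforce
  have "norm (E *v x) \<le> c * norm x" for x
  proof -
    have Eb: "(E *v x) \<bullet> b = d b * (x \<bullet> b)" if "b \<in> B" for b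
      using that B unfolding eigenbasis_def d_def by (metis self_adjointD[OF sa] inner_scaleR_right)
    have "(norm (E *v x))\<^sup>2 = (\<Sum>b\<in>B. (d b * (x \<bullet> b))\<^sup>2)"
      unfolding power2_norm_eq_inner
      by (subst orthonormal_inner[OF oB(1)]) (auto simp: oB Eb power2_eq_square intro!: sum.cong)
    also have "\<dots> \<le> (\<Sum>b\<in>B. c\<^sup>2 * (x \<bullet> b)\<^sup>2)"
      unfolding power_mult_distrib using d by (intro sum_mono mult_right_mono power_mono) auto
    also have "\<dots> = (c * norm x)\<^sup>2"
      unfolding power_mult_distrib power2_norm_eq_inner[of x]
      by (subst orthonormal_inner[OF oB(1), of x]) (auto simp: oB sum_distrib_left power2_eq_square)
    finally show ?thesis by (rule power2_le_imp_le) (use c0 in simp)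
  qed
  then show ?thesis unfolding spectral_norm_def by (rule onorm_le)
qed

text \<open>
  Completing the square. With \<open>b = Z\<^sup>t A x\<close> the form of \<open>A\<close> at \<open>x - Z w\<close> is \<open>x \<bullet> A x - 2 (b \<bullet> w) + w \<bullet> W w\<close>,
  and \<open>w0 = W\<^sup>\<dagger> b\<close> minimizes it because \<open>b\<close> lies in the range of \<open>W\<close>. The last part, attainment, serves to
  show that \<open>E\<close> is positive semidefinite.
\<close>
lemma Nystrom_residual_form:
  fixes A :: "real^'n^'n" and Z :: "real^'l^'n"
  assumes A: "positive_semidefinite A"
  defines "W \<equiv> transpose Z ** A ** Z"
  defines "E \<equiv> A - (A ** Z) ** pinv W ** transpose (A ** Z)"
  shows "transpose E = E"
    and "x \<bullet> (E *v x) \<le> (x - Z *v w) \<bullet> (A *v (x - Z *v w))"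
    and "\<exists>w. x \<bullet> (E *v x) = (x - Z *v w) \<bullet> (A *v (x - Z *v w))"
proof -
  have At: "transpose A = A" using A by (simp add: positive_semidefinite_def)
  note sa = self_adjoint_matrix[OF At]
  have Zt: "(x v* Z) \<bullet> w = x \<bullet> (Z *v w)" for x w by (rule dot_lmul_matrix)
  have Wt: "transpose W = W"
    by (simp add: W_def matrix_transpose_mul At matrix_mul_assoc)
  define X where "X = pinv W"
  have X: "transpose X = X" "W ** X ** W = W"
    using pinv_symmetric[OF Wt] by (auto simp: X_def)
  have Wq: "W *v w = (A *v (Z *v w)) v* Z" for w
    by (simp add: W_def matrix_vector_mul_assoc[symmetric])
  show "transpose E = E"
  proof -
    have "transpose (A ** Z ** X ** transpose (A ** Z)) = A ** Z ** X ** transpose (A ** Z)"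
      by (simp add: matrix_transpose_mul X(1) matrix_mul_assoc)
    moreover have "transpose (M - N) = transpose M - transpose N" for M N :: "real^'n^'n"
      by (simp add: transpose_def vec_eq_iff)
    ultimately show ?thesis by (simp add: E_def X_def At)
  qed
  \<comment> \<open>\<open>A Z W\<^sup>\<dagger> W = A Z\<close>: the kernels of \<open>W\<close> and of \<open>A Z\<close> agree\<close>
  have CXW: "A *v (Z *v (X *v (W *v v))) = A *v (Z *v v)" for v
  proof -
    define v' where "v' = X *v (W *v v) - v"
    have "W *v (X *v (W *v v)) = W *v v" using X(2) by (metis matrix_vector_mul_assoc)
    then have "W *v v' = 0" by (simp add: v'_def matrix_vector_mult_diff_distrib)
    then have "(Z *v v') \<bullet> (A *v (Z *v v')) = 0"
      using Zt[of "A *v (Z *v v')" v'] Wq[of v'] by (simp add: inner_commute)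
    then have "A *v (Z *v v') = 0" by (rule psd_isotropic_imp_kernel[OF A])
    then show ?thesis by (simp add: v'_def matrix_vector_mult_diff_distrib)
  qed
  have Xsa: "(X *v a) \<bullet> b = a \<bullet> (X *v b)" for a b
    by (rule self_adjointD[OF self_adjoint_matrix[OF X(1)]])
  have Wsa: "(W *v a) \<bullet> b = a \<bullet> (W *v b)" for a b
    by (rule self_adjointD[OF self_adjoint_matrix[OF Wt]])
  define b where "b = (A *v x) v* Z"
  define w0 where "w0 = X *v b"
  have Ct: "x v* (A ** Z) = b"
    by (simp add: b_def matrix_transpose_mul At flip: transpose_matrix_vector matrix_vector_mul_assoc)
  have Ww0: "W *v w0 = b"
  proof (rule vector_eq_ldot[THEN iffD1], rule allI)
    fix v
    have "v \<bullet> (W *v w0) = (X *v (W *v v)) \<bullet> b" by (simp add: w0_def Wsa Xsa)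
    also have "\<dots> = (A *v x) \<bullet> (Z *v (X *v (W *v v)))"
      using Zt[of "A *v x" "X *v (W *v v)"] by (simp only: b_def inner_commute)
    also have "\<dots> = x \<bullet> (A *v (Z *v v))" by (simp add: self_adjointD[OF sa] CXW)
    also have "\<dots> = v \<bullet> b" using Zt[of "A *v x" v] by (metis b_def self_adjointD[OF sa] inner_commute)
    finally show "v \<bullet> (W *v w0) = v \<bullet> b" .
  qed
  have Ex: "x \<bullet> (E *v x) = x \<bullet> (A *v x) - b \<bullet> w0"
  proof -
    have "E *v x = A *v x - (A ** Z) *v w0"
      by (simp add: E_def X_def[symmetric] matrix_vector_mult_diff_rdistrib w0_def Ct
          flip: matrix_vector_mul_assoc)
    moreover have "x \<bullet> ((A ** Z) *v w0) = b \<bullet> w0"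
      using dot_lmul_matrix[of x "A ** Z" w0] by (simp add: Ct)
    ultimately show ?thesis by (simp add: inner_diff_right)
  qed
  have q: "(x - Z *v w) \<bullet> (A *v (x - Z *v w)) = x \<bullet> (E *v x) + (Z *v (w - w0)) \<bullet> (A *v (Z *v (w - w0)))" for w
  proof -
    have ZAZ: "(Z *v a) \<bullet> (A *v (Z *v c)) = a \<bullet> (W *v c)" for a c
      using Zt[of "A *v (Z *v c)" a] by (simp add: Wq inner_commute)
    have xAZ: "x \<bullet> (A *v (Z *v w)) = b \<bullet> w" "(Z *v w) \<bullet> (A *v x) = b \<bullet> w"
      using Zt[of "A *v x" w] self_adjointD[OF sa, of x "Z *v w"] by (simp_all add: b_def inner_commute[of "Z *v w"])
    have "(x - Z *v w) \<bullet> (A *v (x - Z *v w)) = x \<bullet> (A *v x) - 2 * (b \<bullet> w) + w \<bullet> (W *v w)"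
      by (simp add: matrix_vector_mult_diff_distrib inner_diff_left inner_diff_right xAZ ZAZ)
    moreover have "(Z *v (w - w0)) \<bullet> (A *v (Z *v (w - w0))) = w \<bullet> (W *v w) - 2 * (b \<bullet> w) + b \<bullet> w0"
    proof -
      have "w0 \<bullet> (W *v w) = b \<bullet> w" using Wsa[of w0 w] Ww0 by simp
      then show ?thesis
        unfolding ZAZ by (simp add: matrix_vector_mult_diff_distrib inner_diff_left inner_diff_right Ww0 inner_commute)
    qed
    ultimately show ?thesis by (simp add: Ex)
  qed
  show "x \<bullet> (E *v x) \<le> (x - Z *v w) \<bullet> (A *v (x - Z *v w))"
    using q[of w] A by (simp add: positive_semidefinite_def)
  show "\<exists>w. x \<bullet> (E *v x) = (x - Z *v w) \<bullet> (A *v (x - Z *v w))"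
    using q[of w0] by (intro exI[of _ w0]) simp
qed

section \<open>Error of the Nystroem extension for well-conditioned columns\<close>

definition selection_matrix :: "('l \<Rightarrow> 'n) \<Rightarrow> real^'l^'n" where
  "selection_matrix c = (\<chi> i j. if i = c j then 1 else 0)"

lemma selection_matrix_columns: "sampled_columns A c = A ** selection_matrix c"
  by (simp add: sampled_columns_def selection_matrix_def matrix_matrix_mult_def vec_eq_iff
      mult_delta_right)

lemma selection_matrix_transpose_vec: "(z v* selection_matrix c) $ j = z $ c j"
  by (simp add: selection_matrix_def vector_matrix_mult_def mult_delta_right)

lemma selection_matrix_submatrix:
  "sampled_submatrix A c = transpose (selection_matrix c) ** A ** selection_matrix c"
proof -
  have "(\<Sum>k\<in>UNIV. (if k = c i then 1 else 0) * A $ k $ c j) = A $ c i $ c j" for i j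
    by (simp add: mult_delta_left)
  then show ?thesis
    by (simp add: matrix_mul_assoc[symmetric] selection_matrix_columns[symmetric])
       (simp add: sampled_submatrix_def sampled_columns_def selection_matrix_def transpose_def
         matrix_matrix_mult_def vec_eq_iff)
qed

lemma selection_matrix_isometry:
  fixes c :: "'l::finite \<Rightarrow> 'n::finite"
  assumes "inj c"
  shows "(selection_matrix c *v w) \<bullet> (selection_matrix c *v w) = w \<bullet> w"
proof -
  have "((selection_matrix c *v w) v* selection_matrix c) $ j = w $ j" for j
  proof -
    have "(selection_matrix c *v w) $ c j = (\<Sum>i\<in>UNIV. if i = j then w $ i else 0)"
      unfolding selection_matrix_def matrix_vector_mult_def
      using assms by (simp add: inj_eq mult_delta_left)
    then show ?thesis by (simp add: selection_matrix_transpose_vec)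
  qed
  then have "(selection_matrix c *v w) v* selection_matrix c = w" by (simp add: vec_eq_iff)
  then show ?thesis
    using dot_lmul_matrix[of "selection_matrix c *v w" "selection_matrix c" w] by (simp add: inner_commute)
qed

text \<open>
  With \<open>M = P Z Z\<^sup>t P\<close>, which is at least \<open>t\<close> on the range of \<open>P\<close>, take \<open>w = Z\<^sup>t z\<close> where \<open>z\<close> solves
  \<open>M z = P x\<close>. This is the minimum-norm solution, that is, the pseudoinverse of \<open>P Z\<close> applied to \<open>P x\<close>.
\<close>
lemma projected_column_combination:
  fixes P :: "real^'n \<Rightarrow> real^'n" and Z :: "real^'l^'n"
  assumes P: "self_adjoint P" "\<And>x. P (P x) = P x" and t: "0 < t"
    and lower: "\<And>z. P z = z \<Longrightarrow> t * (z \<bullet> z) \<le> (z v* Z) \<bullet> (z v* Z)"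
  shows "\<exists>w. P (Z *v w) = P x \<and> t * (w \<bullet> w) \<le> P x \<bullet> P x"
proof -
  have linP: "linear P" by (rule self_adjoint_linear[OF P(1)])
  \<comment> \<open>\<open>M\<close> on the range of \<open>P\<close>, the identity on its kernel; adding the latter makes the operator injective\<close>
  define K where "K z = P (Z *v (P z v* Z)) + (z - P z)" for z
  have PK: "P (K z) = P (Z *v (P z v* Z))" for z
    by (simp add: K_def linear_add[OF linP] linear_diff[OF linP] P(2))
  have linK: "linear K"
    by (rule linearI)
       (simp_all add: K_def linear_add[OF linP] linear_scale[OF linP] vector_matrix_left_distrib
         scaleR_vector_matrix_assoc matrix_vector_right_distrib matrix_vector_mult_scaleR algebra_simps)
  have form: "z \<bullet> P (Z *v (z v* Z)) = (z v* Z) \<bullet> (z v* Z)" if "P z = z" for z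
    using self_adjointD[OF P(1), of z "Z *v (z v* Z)"] dot_lmul_matrix[of z Z "z v* Z"] that by simp
  have "z = 0" if "K z = 0" for z
  proof -
    have "P (Z *v (P z v* Z)) = 0" using PK[of z] that linear_0[OF linP] by simp
    moreover from this have Pz: "P z = z" using that by (simp add: K_def)
    ultimately have "(z v* Z) \<bullet> (z v* Z) = 0" using form[OF Pz] by simp
    then have "t * (z \<bullet> z) \<le> 0" using lower[OF Pz] by simp
    then show "z = 0" using t inner_ge_zero[of z] by (simp add: mult_le_0_iff)
  qed
  then have "inj K" by (simp add: linear_injective_0[OF linK])
  then have "surj K" by (rule eucl.linear_inj_imp_surj[OF linK])
  then obtain z where z: "K z = P x" by (metis surjD)
  have "P (Z *v (P z v* Z)) = P x" using PK[of z] z P(2) by simp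
  moreover from this have Pz: "P z = z" using z by (simp add: K_def)
  ultimately have Pw: "P (Z *v (z v* Z)) = P x" by simp
  define w where "w = z v* Z"
  have ww: "w \<bullet> w = z \<bullet> P x" using form[OF Pz] Pw by (simp add: w_def)
  have "t * (w \<bullet> w) \<le> P x \<bullet> P x"
  proof (cases "w \<bullet> w = 0")
    case False
    then have pos: "w \<bullet> w > 0" by (simp add: less_le)
    have "(w \<bullet> w) * (t * (w \<bullet> w)) = t * (z \<bullet> P x)\<^sup>2" by (simp add: ww power2_eq_square)
    also have "\<dots> \<le> t * ((z \<bullet> z) * (P x \<bullet> P x))"
      using t by (intro mult_left_mono Cauchy_Schwarz_ineq) auto
    also have "\<dots> = (t * (z \<bullet> z)) * (P x \<bullet> P x)" by simp
    also have "\<dots> \<le> (w \<bullet> w) * (P x \<bullet> P x)"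
      using lower[OF Pz] by (intro mult_right_mono) (auto simp: w_def)
    finally show ?thesis using pos by simp
  qed simp
  then show ?thesis using Pw w_def by blast
qed

text \<open>
  Take the residual \<open>r = x - Z w\<close> with \<open>P r = 0\<close>. Its norm is at most \<open>|x - P x| + |Z w|\<close>, where
  \<open>t |Z w|\<^sup>2 \<le> |P x|\<^sup>2\<close>; Cauchy--Schwarz and Pythagoras give \<open>|r|\<^sup>2 \<le> (1 + 1/t) |x|\<^sup>2\<close>.
\<close>
lemma Nystrom_error_le:
  fixes A :: "real^'n^'n" and c :: "'l::finite \<Rightarrow> 'n" and P :: "real^'n \<Rightarrow> real^'n"
  assumes A: "positive_semidefinite A" and c: "inj c"
    and P: "self_adjoint P" "\<And>x. P (P x) = P x" and t: "0 < t"
    and lower: "\<And>z. P z = z \<Longrightarrow> t * (z \<bullet> z) \<le> (\<Sum>i\<in>range c. (z $ i)\<^sup>2)"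
    and upper: "\<And>x. P x = 0 \<Longrightarrow> x \<bullet> (A *v x) \<le> \<kappa> * (x \<bullet> x)" and lam: "0 \<le> \<kappa>"
  shows "spectral_norm (A - nystrom_extension A c) \<le> \<kappa> * (1 + 1 / t)"
proof (rule spectral_norm_le_quadratic_form)
  define Z where "Z = selection_matrix c"
  have E: "A - nystrom_extension A c
      = A - (A ** Z) ** pinv (transpose Z ** A ** Z) ** transpose (A ** Z)"
    by (simp only: nystrom_extension_def selection_matrix_columns selection_matrix_submatrix Z_def)
  note form = Nystrom_residual_form[OF A, where Z = Z, folded E]
  show "positive_semidefinite (A - nystrom_extension A c)"
    unfolding positive_semidefinite_def
  proof (intro conjI allI)
    show "transpose (A - nystrom_extension A c) = A - nystrom_extension A c" by (rule form(1))
    fix x show "0 \<le> x \<bullet> ((A - nystrom_extension A c) *v x)"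
      using form(3)[of x] A by (auto simp: positive_semidefinite_def)
  qed
  fix x
  have lower': "t * (z \<bullet> z) \<le> (z v* Z) \<bullet> (z v* Z)" if "P z = z" for z
  proof -
    have "(\<Sum>i\<in>range c. (z $ i)\<^sup>2) = (\<Sum>j\<in>UNIV. (z $ c j)\<^sup>2)"
      using c by (simp add: sum.reindex)
    also have "\<dots> = (z v* Z) \<bullet> (z v* Z)"
      by (simp add: inner_vec_def Z_def selection_matrix_transpose_vec power2_eq_square)
    finally show ?thesis using lower[OF that] by simp
  qed
  obtain w where w: "P (Z *v w) = P x" "t * (w \<bullet> w) \<le> P x \<bullet> P x"
    using projected_column_combination[OF P t lower'] by blast
  have linP: "linear P" by (rule self_adjoint_linear[OF P(1)])
  have contr: "norm (v - P v) \<le> norm v" and pyth: "(norm (v - P v))\<^sup>2 + (norm (P v))\<^sup>2 = (norm v)\<^sup>2" for v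
  proof -
    have "P v \<bullet> P v = v \<bullet> P v" by (simp add: self_adjointD[OF P(1)] P(2))
    then show *: "(norm (v - P v))\<^sup>2 + (norm (P v))\<^sup>2 = (norm v)\<^sup>2"
      by (simp add: power2_norm_eq_inner inner_diff_left inner_diff_right inner_commute)
    have "(norm (v - P v))\<^sup>2 \<le> (norm v)\<^sup>2" using * zero_le_power2[of "norm (P v)"] by linarith
    then show "norm (v - P v) \<le> norm v" by (rule power2_le_imp_le) simp
  qed
  define r where "r = x - Z *v w"
  define \<alpha> \<beta> where "\<alpha> = norm (x - P x)" and "\<beta> = norm (Z *v w)"
  have Pr: "P r = 0" by (simp add: r_def linear_diff[OF linP] w(1))
  have "r = (x - P x) - (Z *v w - P (Z *v w))" by (simp add: r_def w(1))
  then have "norm r \<le> \<alpha> + \<beta>"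
    using norm_triangle_ineq4[of "x - P x" "Z *v w - P (Z *v w)"] contr[of "Z *v w"]
    by (simp add: \<alpha>_def \<beta>_def)
  then have "(norm r)\<^sup>2 \<le> (\<alpha> + \<beta>)\<^sup>2" by (intro power_mono) auto
  also have "\<dots> \<le> (1 + 1 / t) * (\<alpha>\<^sup>2 + t * \<beta>\<^sup>2)"
  proof -
    have "0 \<le> (\<alpha> - t * \<beta>)\<^sup>2 / t" using t by simp
    also have "\<dots> = (1 + 1 / t) * (\<alpha>\<^sup>2 + t * \<beta>\<^sup>2) - (\<alpha> + \<beta>)\<^sup>2"
      using t by (simp add: field_simps power2_eq_square)
    finally show ?thesis by simp
  qed
  also have "\<dots> \<le> (1 + 1 / t) * (x \<bullet> x)"
  proof (rule mult_left_mono)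
    have "\<beta>\<^sup>2 = w \<bullet> w" unfolding \<beta>_def power2_norm_eq_inner Z_def by (rule selection_matrix_isometry[OF c])
    then show "\<alpha>\<^sup>2 + t * \<beta>\<^sup>2 \<le> x \<bullet> x"
      using w(2) pyth[of x] by (simp add: \<alpha>_def power2_norm_eq_inner)
  qed (use t in simp)
  finally have r: "r \<bullet> r \<le> (1 + 1 / t) * (x \<bullet> x)" by (simp add: power2_norm_eq_inner)
  have "x \<bullet> ((A - nystrom_extension A c) *v x) \<le> r \<bullet> (A *v r)" unfolding r_def by (rule form(2))
  also have "\<dots> \<le> \<kappa> * (r \<bullet> r)" by (rule upper[OF Pr])
  also have "\<dots> \<le> \<kappa> * ((1 + 1 / t) * (x \<bullet> x))" using r lam by (rule mult_left_mono)
  finally show "x \<bullet> ((A - nystrom_extension A c) *v x) \<le> \<kappa> * (1 + 1 / t) * (x \<bullet> x)" by simp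
qed

section \<open>Uniformly random injections\<close>

text \<open>
  All sets of size \<open>CARD('l)\<close> are the range of equally many injections, because bijections between two
  such sets act on the injections by composition.
\<close>
lemma card_injections_by_range:
  assumes "CARD('l::finite) \<le> CARD('n::finite)"
  obtains N where "N > 0"
    "\<And>Q. card {c :: 'l \<Rightarrow> 'n. inj c \<and> Q (range c)} = N * card {T. card T = CARD('l) \<and> Q T}"
proof -
  define I where "I T = {c :: 'l \<Rightarrow> 'n. bij_betw c UNIV T}" for T
  obtain T0 :: "'n set" where T0: "card T0 = CARD('l)"
    using obtain_subset_with_card_n[OF assms] by blast
  have "I T0 \<noteq> {}"
    using finite_same_card_bij[of "UNIV :: 'l set" T0] T0 by (auto simp: I_def)
  then have N: "card (I T0) > 0" by (simp add: card_gt_0_iff)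
  have I: "card (I T) = card (I T0)" if T: "card T = CARD('l)" for T
  proof -
    obtain g where g: "bij_betw g T T0"
      using finite_same_card_bij[of T T0] T T0 by auto
    have "bij_betw (\<lambda>c. g \<circ> c) (I T) (I T0)"
    proof (rule bij_betw_byWitness[where f' = "\<lambda>c. inv_into T g \<circ> c"])
      show "\<forall>c\<in>I T. inv_into T g \<circ> (g \<circ> c) = c"
        using g by (auto simp: I_def fun_eq_iff bij_betw_def)
      show "\<forall>c\<in>I T0. g \<circ> (inv_into T g \<circ> c) = c"
        using g by (auto simp: I_def fun_eq_iff bij_betw_def) (metis f_inv_into_f rangeI)
      show "(\<lambda>c. g \<circ> c) ` I T \<subseteq> I T0"
        using g by (auto simp: I_def intro: bij_betw_trans)
      show "(\<lambda>c. inv_into T g \<circ> c) ` I T0 \<subseteq> I T"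
        using bij_betw_inv_into[OF g] by (auto simp: I_def intro: bij_betw_trans)
    qed
    then show ?thesis by (rule bij_betw_same_card)
  qed
  have "card {c :: 'l \<Rightarrow> 'n. inj c \<and> Q (range c)} = card (I T0) * card {T. card T = CARD('l) \<and> Q T}" for Q
  proof -
    have "{c :: 'l \<Rightarrow> 'n. inj c \<and> Q (range c)} = (\<Union>T\<in>{T. card T = CARD('l) \<and> Q T}. I T)"
      by (auto simp: I_def bij_betw_def card_image)
    also have "card \<dots> = (\<Sum>T | card T = CARD('l) \<and> Q T. card (I T))"
      by (rule card_UN_disjoint) (auto simp: I_def bij_betw_def)
    also have "\<dots> = card (I T0) * card {T. card T = CARD('l) \<and> Q T}"
      by (simp add: I mult.commute)
    finally show ?thesis .
  qed
  with N show ?thesis by (rule that)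
qed

lemma prob_uniform_without_replacement_range:
  assumes "CARD('l::finite) \<le> CARD('n::finite)"
  shows "measure_pmf.prob (uniform_without_replacement :: ('l \<Rightarrow> 'n) pmf) {c. Q (range c)}
       = subset_mean CARD('l) (\<lambda>T. of_bool (Q T))"
proof -
  obtain N where N: "N > 0"
    "\<And>Q. card {c :: 'l \<Rightarrow> 'n. inj c \<and> Q (range c)} = N * card {T. card T = CARD('l) \<and> Q T}"
    using card_injections_by_range[OF assms] by blast
  have all: "card {c :: 'l \<Rightarrow> 'n. inj c} = N * (CARD('n) choose CARD('l))"
    using N(2)[of "\<lambda>_. True"] n_subsets[of "UNIV :: 'n set" "CARD('l)"] by simp
  have ne: "{c :: 'l \<Rightarrow> 'n. inj c} \<noteq> {}"
  proof
    assume "{c :: 'l \<Rightarrow> 'n. inj c} = {}"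
    then have "N * (CARD('n) choose CARD('l)) = 0" using all by simp
    then show False using N(1) assms by simp
  qed
  have "measure_pmf.prob (uniform_without_replacement :: ('l \<Rightarrow> 'n) pmf) {c. Q (range c)}
      = real (card {c :: 'l \<Rightarrow> 'n. inj c \<and> Q (range c)}) / real (card {c :: 'l \<Rightarrow> 'n. inj c})"
    unfolding uniform_without_replacement_def
    by (subst measure_pmf_of_set[OF ne]) (simp_all add: Int_def)
  also have "\<dots> = real (card {T. card T = CARD('l) \<and> Q T}) / real (CARD('n) choose CARD('l))"
    using N(1) by (simp add: N(2) all)
  also have "real (card {T. card T = CARD('l) \<and> Q T}) = (\<Sum>T | card T = CARD('l). of_bool (Q T))"
    by (simp add: of_bool_def sum.If_cases Int_def)
  finally show ?thesis by (simp add: subset_mean_def)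
qed

section \<open>Orthogonal projections onto a span\<close>

definition span_proj :: "'a::euclidean_space set \<Rightarrow> 'a \<Rightarrow> 'a" where
  "span_proj U x = (\<Sum>b\<in>U. (x \<bullet> b) *\<^sub>R b)"

lemma self_adjoint_span_proj: "self_adjoint (span_proj U)"
proof -
  have "linear (span_proj U)"
    by (rule linearI) (simp_all add: span_proj_def inner_add_left scaleR_add_left sum.distrib scaleR_sum_right)
  moreover have "span_proj U x \<bullet> y = x \<bullet> span_proj U y" for x y
    by (simp add: span_proj_def inner_sum_left inner_sum_right inner_commute[of _ y] mult.commute)
  ultimately show ?thesis by (simp add: self_adjoint_def)
qed

lemma span_proj_in_span: "span_proj U x \<in> span U"
  unfolding span_proj_def by (intro span_sum span_scale span_base)

lemma span_proj_fix: "orthonormal U \<Longrightarrow> x \<in> span U \<Longrightarrow> span_proj U x = x"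
  unfolding span_proj_def by (rule orthonormal_expand)

lemma span_proj_idem: "orthonormal U \<Longrightarrow> span_proj U (span_proj U x) = span_proj U x"
  by (simp add: span_proj_fix span_proj_in_span)

lemma span_proj_residual_orthogonal:
  assumes "orthonormal U" "z \<in> span U"
  shows "(x - span_proj U x) \<bullet> z = 0"
  using self_adjointD[OF self_adjoint_span_proj, of U x z] span_proj_fix[OF assms]
  by (simp add: inner_diff_left)

lemma orth_proj_span:
  assumes U: "orthonormal U"
  shows "orth_proj (span U) = span_proj U"
proof
  fix x
  show "orth_proj (span U) x = span_proj U x"
    unfolding orth_proj_def
  proof (rule the_equality)
    show "span_proj U x \<in> span U \<and> (\<forall>z\<in>span U. orthogonal (x - span_proj U x) z)"
      using span_proj_in_span span_proj_residual_orthogonal[OF U] by (auto simp: orthogonal_def)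
    fix y assume y: "y \<in> span U \<and> (\<forall>z\<in>span U. orthogonal (x - y) z)"
    define d where "d = y - span_proj U x"
    have d: "d \<in> span U" using y span_proj_in_span by (auto simp: d_def intro: span_diff)
    have "d \<bullet> d = (x - span_proj U x) \<bullet> d - (x - y) \<bullet> d" by (simp add: d_def inner_diff_left)
    also have "\<dots> = 0" using span_proj_residual_orthogonal[OF U d] y d by (simp add: orthogonal_def)
    finally show "y = span_proj U x" by (simp add: d_def)
  qed
qed

lemma op_trace_span_proj:
  assumes "orthonormal U"
  shows "op_trace (span_proj U) = real (card U)"
proof -
  have "op_trace (span_proj U) = (\<Sum>b\<in>Basis. \<Sum>u\<in>U. (u \<bullet> b) * (u \<bullet> b))"
    by (simp add: op_trace_def span_proj_def inner_sum_right inner_commute)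
  also have "\<dots> = (\<Sum>u\<in>U. u \<bullet> u)"
    by (subst sum.swap) (simp only: euclidean_inner[symmetric])
  also have "\<dots> = real (card U)" using assms by (simp add: orthonormal_def)
  finally show ?thesis .
qed

text \<open>
  The projected coordinate vectors form a Parseval frame of the range of \<open>P\<close>.
\<close>
lemma projected_axes_frame:
  fixes P :: "real^'n \<Rightarrow> real^'n"
  assumes P: "self_adjoint P" "\<And>x. P (P x) = P x"
  shows "P (axis i 1) \<bullet> x = P x $ i"
    and "frame_rest (\<lambda>i. P (axis i 1)) {} = P"
proof -
  show c: "P (axis i 1) \<bullet> x = P x $ i" for i x
    by (simp add: self_adjointD[OF P(1)] inner_axis')
  show "frame_rest (\<lambda>i. P (axis i 1)) {} = P"
  proof (rule ext, rule vector_eq_rdot[THEN iffD1], rule allI)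
    fix x v
    have "frame_rest (\<lambda>i. P (axis i 1)) {} x \<bullet> v = (\<Sum>i\<in>UNIV. P x $ i * P v $ i)"
      by (simp add: frame_rest_def inner_sum_left c)
    also have "\<dots> = P x \<bullet> P v" by (simp add: inner_vec_def)
    also have "\<dots> = P x \<bullet> v" using self_adjointD[OF P(1), of "P x" v] P(2) by simp
    finally show "frame_rest (\<lambda>i. P (axis i 1)) {} x \<bullet> v = P x \<bullet> v" .
  qed
qed

section \<open>The tail of the sample and the error bound\<close>

text \<open>
  The strict inequality comes from \<open>ln 2 < 3/4\<close>, which leaves room between \<open>(1 - ln 2)/2\<close> and \<open>1/8\<close>
  for every \<open>x > 0\<close>, also when \<open>k = \<delta>\<close>.
\<close>
lemma sample_size_tail:
  fixes k \<delta> x :: real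
  assumes k: "0 < k" and d: "0 < \<delta>" and x: "0 < x" "8 * ln (k / \<delta>) \<le> x"
  shows "k * exp (- ((1 - ln 2) / 2 * x)) < \<delta>"
proof -
  have "ln 2 < (3 / 4 :: real)" using ln2_le_25_over_36 by simp
  then have "(1 / 8) * x < (1 - ln 2) / 2 * x" using x by (intro mult_strict_right_mono) auto
  then have "ln (k / \<delta>) < (1 - ln 2) / 2 * x" using x by linarith
  then have "exp (- ((1 - ln 2) / 2 * x)) < exp (- ln (k / \<delta>))" by simp
  also have "exp (- ln (k / \<delta>)) = \<delta> / k" using k d by (simp add: exp_minus)
  finally show ?thesis using k by (simp add: field_simps)
qed

theorem corollary1:
  fixes A :: "real^'n^'n" and S :: "(real^'n) set" and n k l :: nat and \<tau> \<delta> :: real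
  assumes "n = CARD('n)" and "l = CARD('l::finite)"
    and "positive_semidefinite A"
    and "1 \<le> k" and "k \<le> n"
    and "dominant_invariant_subspace A k S"
    and "\<tau> = coherence S"
    and "0 < \<delta>" and "\<delta> \<le> 1"
    and "1 \<le> l" and "l \<le> n"
    and "real l \<ge> 8 * \<tau> * real k * ln (real k / \<delta>)"
  shows "measure_pmf.prob (uniform_without_replacement :: ('l \<Rightarrow> 'n) pmf)
           {c. spectral_norm (A - nystrom_extension A c)
                 \<le> eigval A (k + 1) * (1 + 2 * real n / real l)}
         > 1 - \<delta>"
proof -
  obtain u where u: "\<forall>i\<in>{1..k}. \<forall>j\<in>{1..k}. u i \<bullet> u j = (if i = j then 1 else 0)"
      "\<forall>i\<in>{1..k}. A *v u i = eigval A i *\<^sub>R u i" "S = span (u ` {1..k})"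
    using assms(6) by (auto simp: dominant_invariant_subspace_def)
  define U where "U = u ` {1..k}"
  have inj: "inj_on u {1..k}" using u(1) by (intro inj_onI) (metis zero_neq_one)
  have cardU: "card U = k" using inj by (simp add: U_def card_image)
  have U: "orthonormal U" using u(1) inj by (auto simp: orthonormal_def U_def inj_on_eq_iff)
  define P where "P = span_proj U"
  have P: "self_adjoint P" "\<And>x. P (P x) = P x"
    by (simp_all add: P_def self_adjoint_span_proj span_proj_idem[OF U])
  define y where "y i = P (axis i 1)" for i :: 'n
  have y_inner: "y i \<bullet> x = P x $ i" for i x
    by (simp add: y_def projected_axes_frame(1)[OF P])
  have frame: "frame_rest y {} = P"
    using projected_axes_frame(2)[OF P] by (simp add: y_def[abs_def])
  have y_norm: "y i \<bullet> y i = matrix P $ i $ i" for i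
    by (simp add: y_inner) (simp add: y_def P(2) matrix_def)
  have sum_y: "(\<Sum>i\<in>UNIV. y i \<bullet> y i) = real k"
    using op_trace_frame_rest[of y "{}"] op_trace_span_proj[OF U] by (simp add: frame P_def cardU)
  define R where "R = (MAX i\<in>UNIV. matrix P $ i $ i)"
  have y_le: "y i \<bullet> y i \<le> R" for i unfolding y_norm R_def by (intro Max_ge) auto
  have "real k \<le> real n * R"
    using sum_mono[of UNIV "\<lambda>i. y i \<bullet> y i" "\<lambda>_. R"] y_le by (simp add: sum_y assms(1))
  then have "0 < real n * R" using assms(4) by linarith
  then have R: "0 < R" and n: "0 < real n" using assms(4,5) by (auto simp: zero_less_mult_iff)
  have S: "S = span U" by (simp only: u(3) U_def)
  have "dim S = k"
    using orthonormal_independent[OF U] cardU by (simp add: S dim_eq_card_independent)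
  moreover have "orth_proj S = P" by (simp add: S P_def orth_proj_span[OF U])
  ultimately have tau: "\<tau> * real k = real n * R"
    using assms(4) by (simp add: assms(7) coherence_def R_def assms(1))
  define x where "x = real l / (real n * R)"
  have x: "0 < x" "8 * ln (real k / \<delta>) \<le> x"
  proof -
    show "0 < x" using assms(10) n R by (simp add: x_def)
    have "8 * ln (real k / \<delta>) * (real n * R) \<le> real l"
      using assms(12) tau[symmetric] by (simp add: mult_ac)
    then show "8 * ln (real k / \<delta>) \<le> x"
      unfolding x_def by (subst pos_le_divide_eq) (use n R in auto)
  qed
  define t where "t = real l / (2 * real n)"
  have t: "0 < t" "t \<le> 1" using assms(10,11) n by (auto simp: t_def)
  \<comment> \<open>\<open>\<theta> = ln 2 / R\<close> is the optimal parameter when the threshold is half the mean\<close>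
  have "subset_mean l (\<lambda>T. of_bool (ill_conditioned y t T))
     \<le> real k * exp (ln 2 / R * t - (1 - exp (- (ln 2 / R * R))) / R * (real l / real CARD('n)))"
    by (rule matrix_Chernoff_without_replacement)
       (use P(2) sum_y assms(1,4,11) y_le R t in \<open>auto simp: frame\<close>)
  also have "ln 2 / R * t - (1 - exp (- (ln 2 / R * R))) / R * (real l / real CARD('n)) = - ((1 - ln 2) / 2 * x)"
    using R n by (simp add: t_def x_def assms(1)[symmetric] exp_minus field_simps)
  also have "real k * exp (- ((1 - ln 2) / 2 * x)) < \<delta>"
    using assms(4,8) x by (intro sample_size_tail) auto
  finally have bad: "subset_mean l (\<lambda>T. of_bool (ill_conditioned y t T)) < \<delta>" .
  let ?p = "uniform_without_replacement :: ('l \<Rightarrow> 'n) pmf"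
  let ?G = "{c :: 'l \<Rightarrow> 'n. spectral_norm (A - nystrom_extension A c) \<le> eigval A (k + 1) * (1 + 2 * real n / real l)}"
  let ?B = "{c :: 'l \<Rightarrow> 'n. ill_conditioned y t (range c)}"
  have good: "c \<in> ?G" if c: "inj c" "c \<notin> ?B" for c
  proof -
    have "spectral_norm (A - nystrom_extension A c) \<le> eigval A (k + 1) * (1 + 1 / t)"
    proof (rule Nystrom_error_le[OF assms(3) c(1) P t(1)])
      show "t * (z \<bullet> z) \<le> (\<Sum>i\<in>range c. (z $ i)\<^sup>2)" if "P z = z" for z
        using c(2) that by (auto simp: ill_conditioned_def frame y_inner not_less)
      show "0 \<le> eigval A (k + 1)" by (rule eigval_nonneg[OF assms(3)])
      fix v assume v: "P v = 0"
      have "u i \<bullet> v = 0" if "i \<in> {1..k}" for i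
        using span_proj_residual_orthogonal[OF U, of "u i" v] v that
        by (simp add: P_def U_def span_base inner_commute)
      then show "v \<bullet> (A *v v) \<le> eigval A (k + 1) * (v \<bullet> v)"
        using assms(1,3,5) u by (intro quadratic_form_le_next_eigval[of A k u]) (auto simp: positive_semidefinite_def)
    qed
    then show ?thesis using n by (simp add: t_def)
  qed
  have inj_ex: "\<exists>c :: 'l \<Rightarrow> 'n. inj c"
    using card_le_inj[of "UNIV :: 'l set" "UNIV :: 'n set"] assms(1,2,11) by auto
  have "1 - \<delta> < 1 - measure_pmf.prob ?p ?B"
    using bad prob_uniform_without_replacement_range[where 'l = 'l and 'n = 'n, of "ill_conditioned y t"] assms(1,2,11)
    by simp
  also have "\<dots> = measure_pmf.prob ?p (- ?B)"
    using measure_pmf.prob_compl[of ?B ?p] by (simp add: Compl_eq_Diff_UNIV)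
  also have "\<dots> \<le> measure_pmf.prob ?p ?G"
    by (intro measure_pmf.finite_measure_mono_AE)
       (use good inj_ex in \<open>auto simp: AE_measure_pmf_iff uniform_without_replacement_def\<close>)
  finally show ?thesis .
qed

end
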